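(* Let $p$ be an odd prime, $k\ge2$, $s\ge k+2$, $r=k+s$, and $0\le l<p^k$. The $p^{(k)}$-Fibonacci number $\mathcal M_{s,k}(l)=\mathcal M\big(\lambda(2r;(x_{(2s,k)},x_{(s,k)}+l))\big)$ is given as follows. (a) If $l=0$, then $\mathcal M_{s,k}(l)=\frac{p^{s-2-k}(p-1)}{2}\big(2(s-1)p^{k+1}-2(s-k)+3\big)$. (b) For $1\le t\le\frac{p-3}{2}$: (i) if $0\le i\le k-2$ and $(t-1)\sum_{\iota=i}^{k-1}p^\iota+p^i\le l\le(t-1)\sum_{\iota=i+1}^{k-1}p^\iota+p^{i+1}-1$, then $$\mathcal M_{s,k}(l)=\tfrac{p^{s-2-k}(p-1)}{2}\Big(2(s-1)p^{k+1}-2(s-k)+3+2t\sum_{j=0}^{k-1}p^j-2\sum_{\mu=0}^{k-i-2}p^\mu\Big);$$ (ii) if $tp^{k-1}\le l\le t\sum_{\iota=0}^{k-1}p^\iota$, then $$\mathcal M_{s,k}(l)=\tfrac{p^{s-2-k}(p-1)}{2}\Big(2(s-1)p^{k+1}-2(s-k)+3+2t\sum_{j=0}^{k-1}p^j\Big).$$ (c) (The case $t=\frac{p-1}{2}$.) (i) If $0\le i\le k-2$ and $\frac{p-3}{2}\sum_{\iota=i}^{k-1}p^\iota+p^i\le l\le\frac{p-3}{2}\sum_{\iota=i+1}^{k-1}p^\iota+p^{i+1}-1$, then $$\mathcal M_{s,k}(l)=\tfrac{p^{s-2-k}(p-1)}{2}\Big(2(s-1)p^{k+1}-2(s-k)+3+(p-1)\sum_{j=0}^{k-1}p^j-2\sum_{\mu=0}^{k-i-2}p^\mu\Big);$$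 (ii) if $1\le i'\le k-1$ and $\frac{p-1}{2}\sum_{\iota=i'}^{k-1}p^\iota\le l\le\frac{p-1}{2}\sum_{\iota=i'-1}^{k-1}p^\iota-1$, then $$\mathcal M_{s,k}(l)=\tfrac{p^{s-2-k}(p-1)}{2}\Big(2(s-1)p^{k+1}-2(s-k)+3-p^k-2\sum_{\theta=1}^{k-1}p^\theta+2\sum_{\mu=k-i'+1}^{k}p^\mu-1\Big);$$ (iii) if $l=\frac{p-1}{2}\sum_{\iota=0}^{k-1}p^\iota$, then $$\mathcal M_{s,k}(l)=\tfrac{p^{s-2-k}(p-1)}{2}\Big(2(s-1)p^{k+1}-2(s-k)+3-p^k-2\sum_{\theta=1}^{k-1}p^\theta-1\Big).$$ (d) For $\frac{p+1}{2}\le t\le p-1$: (i) if $0\le i\le k-2$ and $(t-1)\sum_{\iota=i}^{k-1}p^\iota+p^i\le l\le(t-1)\sum_{\iota=i+1}^{k-1}p^\iota+p^{i+1}-1$, then $$\mathcal M_{s,k}(l)=\tfrac{p^{s-2-k}(p-1)}{2}\Big(2(s-1)p^{k+1}-2(s-k)+3+2(t-p)\sum_{j=0}^{k-1}p^j-2\sum_{\mu=0}^{k-i-2}p^\mu\Big);$$ (ii) if $tp^{k-1}\le l\le t\sum_{\iota=0}^{k-1}p^\iota$, then $$\mathcal M_{s,k}(l)=\tfrac{p^{s-2-k}(p-1)}{2}\Big(2(s-1)p^{k+1}-2(s-k)+3+(2t-2p)\sum_{j=0}^{k-1}p^j\Big).$$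
   Context: Notation: $p$ is an odd prime, $k\ge0$, $r\ge1$ integers with $s=r-k\ge1$, $0\le l<p^k$; $x_{(a,k)}=p^k(ap-(a+1))$ for $a\ge1$. $\lambda(c;(n,i))$ denotes the hook partition $(n-i,1^i)$ of $n$, regarded as a vertex on floor $c$ of the $p$-Bratteli diagram. Paths. $P^{2r}_l$ is the set of all downward paths in the diagram from $\lambda(2r;(x_{(2s,k)},x_{(s,k)}+l))$ to floor $1$. Along a path, blocks $B(i;(m_i,n_i))$ ($m_i$ horizontal nodes and $n_i$ vertical nodes) are removed for $i=2r-1,2r-2,\dots,1$. Explicitly, a path $P$ is determined by arbitrary integers $u_s,u_{s-1},\dots,u_2\in\{0,\dots,p-1\}$ and $u_1\in\{0,\dots,p-2\}$ (distinct choices give distinct paths, and all paths arise). Put $L_s=l$ and, for $j=s,s-1,\dots,2$, $L'_j=L_j+p^ku_j$ and $L_{j-1}=\lfloor L'_j/p\rfloor$. The path visits $\lambda(2(k+j);(x_{(2j,k)},x_{(j,k)}+L_j))$ for $1\le j\le s$, $\lambda(2(k+j)-1;(x_{(2j-1,k)},x_{(j-1,k)}+L'_j))$ for $2\le j\le s$, and $\lambda(2k+1;(p^k(p-1),L_1+p^ku_1))$; below floor $2k+1$ the path is forced. The blocks are, for $2\le j\le s$, $$m_{2(k+j)-1}=p^ku_j,\quad n_{2(k+j)-1}=p^k(p-1-u_j),\quad n_{2(k+j)-2}=L'_j-\lfloor L'_j/p\rfloor,\quad m_{2(k+j)-2}=p^k(p-1)-n_{2(k+j)-2},$$ and $m_{2k+1}=p^ku_1$,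 $n_{2k+1}=p^k(p-2-u_1)$. Descents. For $2k+2\le i\le 2r-2$, $P$ has a descent at block $i$ if $m_i>m_{i+1}$ and $n_i<n_{i+1}$ (these blocks all have size $m_i+n_i=p^k(p-1)$). By convention $P$ has a descent at block $2k$ if and only if $u_1<\frac{p-1}{2}$, it has no descent at block $2k+1$, and none at blocks below $2k$. $\mathrm{des}(P)$ is the number of descents of $P$. The $p^{(k)}$-Fibonacci number of the vertex is $$\mathcal M_{s,k}(l):=\mathcal M\big(\lambda(2r;(x_{(2s,k)},x_{(s,k)}+l))\big)=\sum_{P\in P^{2r}_l}\mathrm{des}(P).$$ *)

theory Defs
  imports Complex_Main "HOL-Library.FuncSet" "HOL-Computational_Algebra.Primes"
begin

definition x_num :: "nat \<Rightarrow> nat \<Rightarrow> nat \<Rightarrow> nat" where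
  "x_num p k a = p ^ k * (a * p - (a + 1))"

text \<open>A vertex is a floor together with a partition, given as its list of parts;
  \<open>hook_vertex c n i\<close> is the hook partition \<open>(n - i, 1, \<dots>, 1)\<close> (with \<open>i\<close> ones) on floor \<open>c\<close>.\<close>

type_synonym vertex = "nat \<times> nat list"

definition hook_vertex :: "nat \<Rightarrow> nat \<Rightarrow> nat \<Rightarrow> vertex" where
  "hook_vertex c n i = (c, (n - i) # replicate i 1)"

definition arm :: "vertex \<Rightarrow> nat" where
  "arm v = hd (snd v)"

definition leg :: "vertex \<Rightarrow> nat" where
  "leg v = length (snd v) - 1"

definition path_params :: "nat \<Rightarrow> nat \<Rightarrow> (nat \<Rightarrow> nat) set" where
  "path_params p s = (\<Pi>\<^sub>E j\<in>{1..s}. if j = 1 then {0..p - 2} else {0..p - 1})"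

text \<open>The numbers \<open>L\<^sub>s = l\<close>, \<open>L\<^sub>j\<^sub>-\<^sub>1 = \<lfloor>(L\<^sub>j + p\<^sup>k u\<^sub>j) / p\<rfloor>\<close> are computed downwards from \<open>j = s\<close>;
  the auxiliary function is indexed by the number \<open>s - j\<close> of steps.\<close>

primrec L_down :: "nat \<Rightarrow> nat \<Rightarrow> nat \<Rightarrow> nat \<Rightarrow> (nat \<Rightarrow> nat) \<Rightarrow> nat \<Rightarrow> nat" where
  "L_down p k s l u 0 = l"
| "L_down p k s l u (Suc d) = (L_down p k s l u d + p ^ k * u (s - d)) div p"

definition L_num :: "nat \<Rightarrow> nat \<Rightarrow> nat \<Rightarrow> nat \<Rightarrow> (nat \<Rightarrow> nat) \<Rightarrow> nat \<Rightarrow> nat" where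
  "L_num p k s l u j = L_down p k s l u (s - j)"

definition L'_num :: "nat \<Rightarrow> nat \<Rightarrow> nat \<Rightarrow> nat \<Rightarrow> (nat \<Rightarrow> nat) \<Rightarrow> nat \<Rightarrow> nat" where
  "L'_num p k s l u j = L_num p k s l u j + p ^ k * u j"

lemma L_num_top: "L_num p k s l u s = l"
  by (simp add: L_num_def)

lemma L_num_step:
  assumes "2 \<le> j" "j \<le> s"
  shows "L_num p k s l u (j - 1) = L'_num p k s l u j div p"
proof -
  have "s - (j - 1) = Suc (s - j)" "s - (s - j) = j" using assms by auto
  then show ?thesis by (simp add: L_num_def L'_num_def)
qed

text \<open>A path is given by the vertices it visits, indexed by their floors.  Only the floors
  \<open>2k+1, \<dots>, 2(k+s)\<close> are recorded: below floor \<open>2k+1\<close> the path is forced, so that a path down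
  to floor 1 is the same thing as its part above.\<close>

definition path_with_params ::
  "nat \<Rightarrow> nat \<Rightarrow> nat \<Rightarrow> nat \<Rightarrow> (nat \<Rightarrow> nat) \<Rightarrow> (nat \<Rightarrow> vertex) \<Rightarrow> bool" where
  "path_with_params p k s l u P \<longleftrightarrow>
     P \<in> extensional {2 * k + 1..2 * (k + s)} \<and>
     (\<forall>j\<in>{1..s}. P (2 * (k + j)) =
        hook_vertex (2 * (k + j)) (x_num p k (2 * j)) (x_num p k j + L_num p k s l u j)) \<and>
     (\<forall>j\<in>{2..s}. P (2 * (k + j) - 1) =
        hook_vertex (2 * (k + j) - 1) (x_num p k (2 * j - 1))
          (x_num p k (j - 1) + L'_num p k s l u j)) \<and>
     P (2 * k + 1) = hook_vertex (2 * k + 1) (p ^ k * (p - 1)) (L'_num p k s l u 1)"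

definition paths :: "nat \<Rightarrow> nat \<Rightarrow> nat \<Rightarrow> nat \<Rightarrow> (nat \<Rightarrow> vertex) set" where
  "paths p k s l = {P. \<exists>u\<in>path_params p s. path_with_params p k s l u P}"

text \<open>Block \<open>i\<close> of a path consists of the nodes removed on the way from floor \<open>i + 1\<close> to floor \<open>i\<close>;
  the closed formulas for its horizontal and vertical nodes are proved below.\<close>

definition block_m :: "(nat \<Rightarrow> vertex) \<Rightarrow> nat \<Rightarrow> int" where
  "block_m P i = int (arm (P (i + 1))) - int (arm (P i))"

definition block_n :: "(nat \<Rightarrow> vertex) \<Rightarrow> nat \<Rightarrow> int" where
  "block_n P i = int (leg (P (i + 1))) - int (leg (P i))"

text \<open>As block \<open>2k+1\<close> has \<open>p\<^sup>k u\<^sub>1\<close> horizontal nodes, the last parameter \<open>u\<^sub>1\<close> can be read off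
  from it.\<close>

definition last_param :: "nat \<Rightarrow> nat \<Rightarrow> (nat \<Rightarrow> vertex) \<Rightarrow> int" where
  "last_param p k P = block_m P (2 * k + 1) div int (p ^ k)"

definition descent_at :: "nat \<Rightarrow> nat \<Rightarrow> nat \<Rightarrow> (nat \<Rightarrow> vertex) \<Rightarrow> nat \<Rightarrow> bool" where
  "descent_at p k s P i \<longleftrightarrow>
     (2 * k + 2 \<le> i \<and> i \<le> 2 * (k + s) - 2 \<and>
        block_m P i > block_m P (i + 1) \<and> block_n P i < block_n P (i + 1)) \<or>
     (i = 2 * k \<and> real_of_int (last_param p k P) < (real p - 1) / 2)"

definition des :: "nat \<Rightarrow> nat \<Rightarrow> nat \<Rightarrow> (nat \<Rightarrow> vertex) \<Rightarrow> nat" where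
  "des p k s P = card {i. descent_at p k s P i}"

definition fib_number :: "nat \<Rightarrow> nat \<Rightarrow> nat \<Rightarrow> nat \<Rightarrow> nat" where
  "fib_number p k s l = (\<Sum>P\<in>paths p k s l. des p k s P)"

lemma arm_hook [simp]: "arm (hook_vertex c n i) = n - i"
  by (simp add: arm_def hook_vertex_def)

lemma leg_hook [simp]: "leg (hook_vertex c n i) = i"
  by (simp add: leg_def hook_vertex_def)

context
  fixes p k s l :: nat and u :: "nat \<Rightarrow> nat" and P :: "nat \<Rightarrow> vertex"
  assumes p: "3 \<le> p" and s: "1 \<le> s" and l: "l < p ^ k"
    and u: "u \<in> path_params p s" and P: "path_with_params p k s l u P"
begin

lemma u_le: "2 \<le> j \<Longrightarrow> j \<le> s \<Longrightarrow> u j \<le> p - 1"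
  using PiE_mem[OF u[unfolded path_params_def], of j] by simp

lemma u1_le: "u 1 \<le> p - 2"
  using PiE_mem[OF u[unfolded path_params_def], of 1] s by simp

lemma L'_num_less:
  assumes "L_num p k s l u j < p ^ k" "2 \<le> j" "j \<le> s"
  shows "L'_num p k s l u j < p * p ^ k"
proof -
  have "p ^ k * u j \<le> p ^ k * (p - 1)" using u_le[of j] assms by simp
  moreover have "p ^ k + p ^ k * (p - 1) = p * p ^ k"
    using p by (cases p) (auto simp: algebra_simps)
  ultimately show ?thesis using assms(1) unfolding L'_num_def by linarith
qed

lemma L_num_less: "1 \<le> j \<Longrightarrow> j \<le> s \<Longrightarrow> L_num p k s l u j < p ^ k"
proof (induction "s - j" arbitrary: j)
  case 0
  then show ?case using l by (simp add: L_num_def)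
next
  case (Suc d)
  then have "L_num p k s l u (j + 1) < p ^ k" by simp
  then have "L'_num p k s l u (j + 1) < p * p ^ k" using Suc L'_num_less[of "j + 1"] by simp
  then show ?case
    using Suc L_num_step[of "j + 1" s p k l u] p
    by (simp add: less_mult_imp_div_less mult.commute)
qed

lemma int_x_num:
  assumes "1 \<le> a"
  shows "int (x_num p k a) = int p ^ k * (int a * int p - int a - 1)"
proof -
  have "a * 3 \<le> a * p" using p by simp
  then have "a + 1 \<le> a * p" using assms by linarith
  then show ?thesis by (simp add: x_num_def of_nat_diff)
qed

lemma block_pos:
  assumes "1 \<le> j" "j \<le> s"
  shows "x_num p k j + L_num p k s l u j \<le> x_num p k (2 * j)"
proof -
  have "int (x_num p k (2 * j)) - int (x_num p k j) = int p ^ k * (int j * (int p - 1))"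
    using assms by (simp add: int_x_num algebra_simps)
  moreover have "int p ^ k * 1 \<le> int p ^ k * (int j * (int p - 1))"
    using p assms mult_mono[of 1 "int j" 1 "int p - 1"] by (intro mult_left_mono) auto
  moreover have "int (L_num p k s l u j) < int p ^ k"
    using L_num_less[OF assms] by (metis of_nat_less_iff of_nat_power)
  ultimately have "int (x_num p k j) + int (L_num p k s l u j) \<le> int (x_num p k (2 * j))"
    by linarith
  then show ?thesis by linarith
qed

lemma block_pos':
  assumes "2 \<le> j" "j \<le> s"
  shows "x_num p k (j - 1) + L'_num p k s l u j \<le> x_num p k (2 * j - 1)"
proof -
  have "int (x_num p k (2 * j - 1)) - int (x_num p k (j - 1))
      = int p ^ k * (int j * (int p - 1))"
    using assms by (simp add: int_x_num of_nat_diff algebra_simps)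
  moreover have "int p ^ k * int p \<le> int p ^ k * (int j * (int p - 1))"
    using p assms mult_right_mono[of 2 "int j" "int p - 1"] by (intro mult_left_mono) auto
  moreover have "int (L'_num p k s l u j) < int p * int p ^ k"
    using L'_num_less[OF L_num_less] assms
    by (metis One_nat_def Suc_1 Suc_leD of_nat_less_iff of_nat_mult of_nat_power)
  ultimately have "int (x_num p k (j - 1)) + int (L'_num p k s l u j) \<le> int (x_num p k (2 * j - 1))"
    by (simp add: mult.commute)
  then show ?thesis by linarith
qed

lemma block_pos1: "L'_num p k s l u 1 \<le> p ^ k * (p - 1)"
proof -
  have "p ^ k * u 1 \<le> p ^ k * (p - 2)" using u1_le by simp
  moreover have "p ^ k * (p - 1) = p ^ k + p ^ k * (p - 2)"
    using p by (metis (no_types, lifting) One_nat_def Suc_1 Suc_diff_Suc Suc_leD Suc_le_lessD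
        mult_Suc_right numeral_3_eq_3)
  ultimately show ?thesis using L_num_less[of 1] s unfolding L'_num_def by linarith
qed

lemma path_even: "1 \<le> j \<Longrightarrow> j \<le> s \<Longrightarrow> P (2 * (k + j)) =
    hook_vertex (2 * (k + j)) (x_num p k (2 * j)) (x_num p k j + L_num p k s l u j)"
  using P unfolding path_with_params_def by auto

lemma path_odd: "2 \<le> j \<Longrightarrow> j \<le> s \<Longrightarrow> P (2 * (k + j) - 1) =
    hook_vertex (2 * (k + j) - 1) (x_num p k (2 * j - 1)) (x_num p k (j - 1) + L'_num p k s l u j)"
  using P unfolding path_with_params_def by auto

lemma path_last:
  "P (2 * k + 1) = hook_vertex (2 * k + 1) (p ^ k * (p - 1)) (L'_num p k s l u 1)"
  using P unfolding path_with_params_def by auto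

lemma path_top: "P (2 * (k + s)) =
    hook_vertex (2 * (k + s)) (x_num p k (2 * s)) (x_num p k s + l)"
  using path_even[of s] s by (simp add: L_num_top)

lemma blocks_odd:
  assumes j: "2 \<le> j" "j \<le> s"
  shows "block_m P (2 * (k + j) - 1) = int p ^ k * int (u j)"
    and "block_n P (2 * (k + j) - 1) = int p ^ k * (int p - 1 - int (u j))"
proof -
  have e: "2 * (k + j) - 1 + 1 = 2 * (k + j)" using j by simp
  have j1: "1 \<le> j" using j by simp
  note v = path_even[OF j1 j(2)] path_odd[OF j]
  show "block_n P (2 * (k + j) - 1) = int p ^ k * (int p - 1 - int (u j))"
    unfolding block_n_def e v leg_hook
    using j by (simp add: int_x_num L'_num_def of_nat_diff algebra_simps)
  show "block_m P (2 * (k + j) - 1) = int p ^ k * int (u j)"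
    unfolding block_m_def e v arm_hook
      of_nat_diff[OF block_pos[OF j1 j(2)]] of_nat_diff[OF block_pos'[OF j]]
    using j by (simp add: int_x_num L'_num_def of_nat_diff algebra_simps)
qed

lemma blocks_even:
  assumes j: "2 \<le> j" "j \<le> s"
  shows "block_n P (2 * (k + j) - 2) = int (L'_num p k s l u j) - int (L'_num p k s l u j div p)"
    and "block_m P (2 * (k + j) - 2) = int p ^ k * (int p - 1) - block_n P (2 * (k + j) - 2)"
proof -
  have e: "2 * (k + j) - 2 + 1 = 2 * (k + j) - 1" using j by simp
  have e': "2 * (k + j) - 2 = 2 * (k + (j - 1))" using j by simp
  have j1: "1 \<le> j - 1" "j - 1 \<le> s" using j by auto
  note v = path_even[OF j1, folded e'] path_odd[OF j]
  show 1: "block_n P (2 * (k + j) - 2)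
      = int (L'_num p k s l u j) - int (L'_num p k s l u j div p)"
    unfolding block_n_def e v leg_hook L_num_step[OF j] by simp
  show "block_m P (2 * (k + j) - 2) = int p ^ k * (int p - 1) - block_n P (2 * (k + j) - 2)"
    unfolding 1 unfolding block_m_def e v arm_hook
      of_nat_diff[OF block_pos[OF j1]] of_nat_diff[OF block_pos'[OF j]]
    using j L_num_step[OF j, of p k l u] by (simp add: int_x_num of_nat_diff algebra_simps)
qed

lemma blocks_last:
  shows "block_m P (2 * k + 1) = int p ^ k * int (u 1)"
    and "block_n P (2 * k + 1) = int p ^ k * (int p - 2 - int (u 1))"
proof -
  have e: "2 * k + 1 + 1 = 2 * (k + 1)" by simp
  have x1: "int (x_num p k 1) = int p ^ k * (int p - 2)" by (simp add: int_x_num)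
  have x2: "int (x_num p k (2 * 1)) = int p ^ k * (2 * int p - 3)" by (simp add: int_x_num)
  have x3: "int (p ^ k * (p - 1)) = int p ^ k * (int p - 1)" using p by (simp add: of_nat_diff)
  note v = path_even[OF order_refl s] path_last
  show "block_n P (2 * k + 1) = int p ^ k * (int p - 2 - int (u 1))"
    unfolding block_n_def e v leg_hook of_nat_add x1 by (simp add: L'_num_def algebra_simps)
  show "block_m P (2 * k + 1) = int p ^ k * int (u 1)"
    unfolding block_m_def e v arm_hook of_nat_diff[OF block_pos[OF order_refl s]]
      of_nat_diff[OF block_pos1] of_nat_add x1 x2 x3
    by (simp add: L'_num_def algebra_simps)
qed

lemma last_param_eq: "last_param p k P = int (u 1)"
  using blocks_last(1) p by (simp add: last_param_def)

end

lemma path_params_unique: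
  assumes "3 \<le> p" "1 \<le> s" "l < p ^ k"
    and u: "u \<in> path_params p s" "path_with_params p k s l u P"
    and w: "w \<in> path_params p s" "path_with_params p k s l w P"
  shows "u = w"
proof (rule PiE_ext[OF u(1)[unfolded path_params_def] w(1)[unfolded path_params_def]])
  fix j assume j: "j \<in> {1..s}"
  show "u j = w j"
  proof (cases "j = 1")
    case True
    then show ?thesis
      using last_param_eq[OF assms(1-3) u] last_param_eq[OF assms(1-3) w] by simp
  next
    case False
    with j have "2 \<le> j" "j \<le> s" by auto
    then have "int p ^ k * int (u j) = int p ^ k * int (w j)"
      using blocks_odd(1)[OF assms(1-3) u] blocks_odd(1)[OF assms(1-3) w] by metis
    then show ?thesis using assms(1) by simp
  qed
qed

lemma path_params_exists:
  assumes "1 \<le> s"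
  shows "\<exists>P. path_with_params p k s l u P"
proof -
  define P where "P = restrict (\<lambda>c.
    if c = 2 * k + 1 then hook_vertex c (p ^ k * (p - 1)) (L'_num p k s l u 1)
    else let j = (c + 1) div 2 - k in
      if even c then hook_vertex c (x_num p k (2 * j)) (x_num p k j + L_num p k s l u j)
      else hook_vertex c (x_num p k (2 * j - 1)) (x_num p k (j - 1) + L'_num p k s l u j))
    {2 * k + 1..2 * (k + s)}"
  have "P (2 * (k + j)) = hook_vertex (2 * (k + j)) (x_num p k (2 * j))
      (x_num p k j + L_num p k s l u j)" if "j \<in> {1..s}" for j
  proof -
    have "(2 * (k + j) + 1) div 2 - k = j" "2 * (k + j) \<noteq> 2 * k + 1" "even (2 * (k + j))"
      "2 * (k + j) \<in> {2 * k + 1..2 * (k + s)}"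
      using that by simp_all presburger?
    then show ?thesis unfolding P_def Let_def by (simp only: restrict_apply' if_True if_False)
  qed
  moreover have "P (2 * (k + j) - 1) = hook_vertex (2 * (k + j) - 1) (x_num p k (2 * j - 1))
      (x_num p k (j - 1) + L'_num p k s l u j)" if "j \<in> {2..s}" for j
  proof -
    have "(2 * (k + j) - 1 + 1) div 2 - k = j" "2 * (k + j) - 1 \<noteq> 2 * k + 1"
      "\<not> even (2 * (k + j) - 1)" "2 * (k + j) - 1 \<in> {2 * k + 1..2 * (k + s)}"
      using that by auto
    then show ?thesis unfolding P_def Let_def by (simp only: restrict_apply' if_True if_False)
  qed
  moreover have "P (2 * k + 1) = hook_vertex (2 * k + 1) (p ^ k * (p - 1)) (L'_num p k s l u 1)"
    if "1 \<le> s" using that by (simp add: P_def)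
  ultimately show ?thesis
    using assms unfolding path_with_params_def by (intro exI[of _ P]) (simp add: P_def)
qed

end

theory Submission
  imports Defs
begin

text \<open>
  The numbers \<open>L'\<^sub>j\<close> form a shift register: \<open>L'\<^sub>j < p\<^sup>k\<^sup>+\<^sup>1\<close> has \<open>k + 1\<close> digits in base \<open>p\<close>, the top one
  being \<open>u\<^sub>j\<close>, and passing to \<open>L\<^sub>j\<^sub>-\<^sub>1\<close> drops the last digit.  Let \<open>R\<^sub>m = 1 + p + \<dots> + p\<^sup>m\<^sup>-\<^sup>1\<close>.  Since
  \<open>X - \<lfloor>X / p\<rfloor>\<close> is monotone in \<open>X\<close> and takes the value \<open>v p\<^sup>k\<close> only at \<open>X = v R\<^sub>k\<^sub>+\<^sub>1\<close> (all digits \<open>v\<close>), both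
  kinds of descents are comparisons of some \<open>L'\<^sub>j\<close> with such a number: the block below \<open>L'\<^sub>j\<close> is a
  descent iff \<open>L'\<^sub>j < (p - 1) / 2 \<cdot> R\<^sub>k\<^sub>+\<^sub>1\<close>, and the block of \<open>u\<^sub>j\<close> is a descent iff
  \<open>(p - 1 - u\<^sub>j) R\<^sub>k\<^sub>+\<^sub>1 < L'\<^sub>j\<^sub>+\<^sub>1\<close>.  After \<open>k\<close> steps all digits of \<open>l\<close> have left the register and it is
  uniformly distributed; before that, \<open>d\<close> steps down, the count deviates from the uniform one by
  whether \<open>\<lfloor>l / p\<^sup>d\<rfloor>\<close> lies above or below the numbers \<open>v R\<^sub>k\<^sub>-\<^sub>d\<close>.  These conditions on \<open>l\<close> are the
  inequalities \<open>v (p\<^sup>d + \<dots> + p\<^sup>k\<^sup>-\<^sup>1) + p\<^sup>d \<le> l\<close>, whose left-hand sides increase lexicographically in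
  \<open>(v, d)\<close>, and \<open>(p - 1) / 2 \<cdot> (p\<^sup>d + \<dots> + p\<^sup>k\<^sup>-\<^sup>1) \<le> l\<close>; the cases of the theorem are the resulting
  intervals.
\<close>

subsection \<open>Repunits and descents\<close>

definition repunit :: "nat \<Rightarrow> nat \<Rightarrow> nat" where
  "repunit p m = (\<Sum>i<m. p ^ i)"

lemma repunit_0 [simp]: "repunit p 0 = 0"
  by (simp add: repunit_def)

lemma repunit_Suc: "repunit p (Suc m) = repunit p m + p ^ m"
  by (simp add: repunit_def)

lemma repunit_Suc_shift: "repunit p (Suc m) = p * repunit p m + 1"
  by (simp only: repunit_def sum.lessThan_Suc_shift) (simp add: sum_distrib_left)

lemma repunit_closed: "1 \<le> p \<Longrightarrow> (p - 1) * repunit p m + 1 = p ^ m"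
proof (induction m)
  case (Suc m)
  have "(p - 1) * repunit p (Suc m) + 1 = ((p - 1) * repunit p m + 1) + (p - 1) * p ^ m"
    by (simp add: repunit_Suc algebra_simps)
  also have "\<dots> = p ^ m + (p - 1) * p ^ m" using Suc by simp
  also have "\<dots> = p ^ Suc m" using Suc.prems by (cases p) auto
  finally show ?case .
qed simp

text \<open>A string of \<open>a + b\<close> ones is \<open>a\<close> leading ones followed by
  \<open>b\<close> trailing ones, the form that a comparison by leading digits needs.\<close>

lemma repunit_add: "repunit p (a + b) = repunit p a * p ^ b + repunit p b"
  by (induction a) (auto simp: repunit_Suc algebra_simps power_add)

lemma mult_repunit_less:
  assumes "v < p"
  shows "v * repunit p m < p ^ m"
proof -
  have "v * repunit p m \<le> (p - 1) * repunit p m" using assms by (intro mult_right_mono) auto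
  then show ?thesis using repunit_closed[of p m] assms by linarith
qed

text \<open>Raising the number by one raises its quotient by at most one, so the difference cannot
  drop.\<close>

lemma diff_div_mono:
  fixes x y p :: nat
  assumes "x \<le> y" "1 \<le> p"
  shows "x - x div p \<le> y - y div p"
  using assms(1)
proof (induction rule: dec_induct)
  case (step n)
  have "Suc n div p \<le> Suc (n div p)" by (simp add: div_Suc)
  moreover have "n div p \<le> n" by simp
  ultimately show ?case using step.IH by linarith
qed simp

text \<open>Division by \<open>p\<close> drops the last digit \<open>v\<close>, and consecutive
  repunits differ by a power of \<open>p\<close>.\<close>

lemma diff_div_mult_repunit:
  assumes "v < p"
  shows "v * repunit p (Suc k) - v * repunit p (Suc k) div p = v * p ^ k"
proof -
  have e: "v * repunit p (Suc k) = v + (v * repunit p k) * p" by (simp add: repunit_Suc_shift algebra_simps)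
  have "v * repunit p (Suc k) div p = v * repunit p k"
    unfolding e using assms by (subst div_mult_self1) auto
  then show ?thesis by (simp add: repunit_Suc algebra_simps)
qed

text \<open>Monotonicity of \<open>X - X div p\<close> leaves only the strictness at
  \<open>X = v * repunit p (Suc k) + 1\<close>: there the last digit grows from \<open>v\<close> to
  \<open>v + 1\<close> without a carry, so the quotient stays and the difference rises by
  one.\<close>

lemma less_diff_div_iff:
  assumes "v < p" "X < p ^ Suc k"
  shows "v * p ^ k < X - X div p \<longleftrightarrow> v * repunit p (Suc k) < X"
proof
  assume *: "v * p ^ k < X - X div p"
  show "v * repunit p (Suc k) < X"
  proof (rule ccontr)
    assume "\<not> v * repunit p (Suc k) < X"
    then have "X - X div p \<le> v * repunit p (Suc k) - v * repunit p (Suc k) div p"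
      using assms by (intro diff_div_mono) auto
    with * diff_div_mult_repunit[OF assms(1), of k] show False by simp
  qed
next
  assume *: "v * repunit p (Suc k) < X"
  \<comment> \<open>For \<open>v = p - 1\<close> the number \<open>v * repunit p (Suc k)\<close> is
    \<open>p ^ Suc k - 1\<close>, and no admissible \<open>X\<close> lies above it.\<close>
  have v: "v + 1 < p"
  proof (rule ccontr)
    assume "\<not> v + 1 < p"
    then have "v = p - 1" using assms by simp
    then show False using * assms repunit_closed[of p "Suc k"] by simp
  qed
  have e: "v * repunit p (Suc k) + 1 = (v + 1) + (v * repunit p k) * p"
    by (simp add: repunit_Suc_shift algebra_simps)
  have "(v * repunit p (Suc k) + 1) div p = v * repunit p k"
    unfolding e using v by (subst div_mult_self1) auto
  then have "v * repunit p (Suc k) + 1 - (v * repunit p (Suc k) + 1) div p = v * p ^ k + 1"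
    by (simp add: repunit_Suc algebra_simps)
  moreover have "v * repunit p (Suc k) + 1 - (v * repunit p (Suc k) + 1) div p \<le> X - X div p"
    using * assms by (intro diff_div_mono) auto
  ultimately show "v * p ^ k < X - X div p" by simp
qed

text \<open>The converse is decided at the predecessor of \<open>v * repunit p (Suc k)\<close>: its
  last digit is \<open>v - 1\<close> and its quotient is unchanged, so the difference there is
  \<open>v * p ^ k - 1\<close>.\<close>

lemma diff_div_less_iff:
  assumes "v < p"
  shows "X - X div p < v * p ^ k \<longleftrightarrow> X < v * repunit p (Suc k)"
proof
  assume *: "X - X div p < v * p ^ k"
  show "X < v * repunit p (Suc k)"
  proof (rule ccontr)
    assume "\<not> X < v * repunit p (Suc k)"
    then have "v * repunit p (Suc k) - v * repunit p (Suc k) div p \<le> X - X div p"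
      using assms by (intro diff_div_mono) auto
    with * diff_div_mult_repunit[OF assms(1), of k] show False by simp
  qed
next
  assume *: "X < v * repunit p (Suc k)"
  then obtain w where w: "v = Suc w" by (cases v) auto
  have e: "v * repunit p (Suc k) = w + (v * repunit p k) * p + 1"
    by (simp add: repunit_Suc_shift algebra_simps w)
  let ?Y = "w + (v * repunit p k) * p"
  have "?Y div p = v * repunit p k"
    using assms w by (subst div_mult_self1) auto
  moreover have "?Y div p \<le> ?Y" by simp
  ultimately have "?Y - ?Y div p + 1 = v * p ^ k"
    using e unfolding repunit_Suc distrib_left by linarith
  moreover have "X - X div p \<le> ?Y - ?Y div p"
    using * e assms by (intro diff_div_mono) auto
  ultimately show "X - X div p < v * p ^ k" by simp
qed

text \<open>The digit \<open>u\<close> leads \<open>L + p ^ k * u\<close>, so for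
  \<open>u < t\<close> both inequalities hold, for \<open>u > t\<close> both fail, and for
  \<open>u = t\<close> the factors \<open>p - 1 - u\<close> and \<open>t\<close> agree. The
  resulting bound is the same for all \<open>u\<close>.\<close>

lemma even_block_descent_iff:
  assumes p: "p = 2 * t + 1" and "u < p" "L < p ^ k"
  shows "L + p ^ k * u - (L + p ^ k * u) div p < (p - 1 - u) * p ^ k
    \<longleftrightarrow> L + p ^ k * u < t * repunit p (Suc k)"
proof -
  have R: "t * repunit p (Suc k) < p ^ k * (t + 1)"
    using mult_repunit_less[of t p k] p by (simp add: repunit_Suc algebra_simps)
  have R': "p ^ k * v \<le> v * repunit p (Suc k)" for v by (simp add: repunit_Suc algebra_simps)
  have "L + p ^ k * u < (p - 1 - u) * repunit p (Suc k) \<longleftrightarrow> L + p ^ k * u < t * repunit p (Suc k)"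
  proof (cases u t rule: linorder_cases)
    case less
    have "L + p ^ k * u < p ^ k * (u + 1)" using assms by simp
    also have "\<dots> \<le> p ^ k * t" using less by (intro mult_left_mono) auto
    also have "\<dots> \<le> t * repunit p (Suc k)" by (rule R')
    finally have 1: "L + p ^ k * u < t * repunit p (Suc k)" .
    also have "\<dots> \<le> (p - 1 - u) * repunit p (Suc k)" using less p by (intro mult_right_mono) auto
    finally show ?thesis using 1 by simp
  next
    case equal
    then show ?thesis using p by simp
  next
    case greater
    have "p ^ k * (t + 1) \<le> p ^ k * u" using greater by (intro mult_left_mono) auto
    then have "\<not> L + p ^ k * u < t * repunit p (Suc k)" using R by linarith
    moreover have "(p - 1 - u) * repunit p (Suc k) \<le> t * repunit p (Suc k)"
      using greater p by (intro mult_right_mono) auto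
    ultimately show ?thesis by linarith
  qed
  then show ?thesis using diff_div_less_iff[of "p - 1 - u" p _ k] p by simp
qed

subsection \<open>Sums over paths\<close>

lemma sum_path_params_1: "(\<Sum>u\<in>path_params p 1. g u) = (\<Sum>v\<le>p - 2. g ((\<lambda>_. undefined)(1 := v)))"
proof -
  have e: "path_params p 1 = (\<lambda>v. (\<lambda>_. undefined)(1 := v)) ` {..p - 2}"
    unfolding path_params_def by (auto simp: PiE_insert_eq image_iff simp flip: atMost_atLeast0)
  have inj: "inj_on (\<lambda>v. (\<lambda>_. undefined)(1 := v)) {..p - 2}"
    by (rule inj_onI) (metis fun_upd_same)
  show ?thesis unfolding e by (subst sum.reindex[OF inj]) (simp add: o_def)
qed

lemma sum_path_params_Suc:
  assumes "1 \<le> s"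
  shows "(\<Sum>u\<in>path_params p (Suc s). g u)
    = (\<Sum>v\<le>p - 1. \<Sum>u\<in>path_params p s. g (u(Suc s := v)))"
proof -
  let ?T = "\<lambda>j. if j = 1 then {0..p - 2} else {0..p - 1}"
  have "{1..Suc s} = insert (Suc s) {1..s}" by auto
  then have e: "path_params p (Suc s)
      = (\<lambda>(y, g). g(Suc s := y)) ` (?T (Suc s) \<times> path_params p s)"
    unfolding path_params_def by (simp only: PiE_insert_eq)
  have inj: "inj_on (\<lambda>(y, g). g(Suc s := y)) (?T (Suc s) \<times> path_params p s)"
    unfolding path_params_def by (rule inj_combinator) simp
  have "?T (Suc s) = {..p - 1}" using assms by auto
  then show ?thesis unfolding e
    by (subst sum.reindex[OF inj]) (simp add: sum.cartesian_product case_prod_unfold)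
qed

lemma card_path_params: "2 \<le> p \<Longrightarrow> card (path_params p (Suc n)) = (p - 1) * p ^ n"
proof (induction n)
  case 0
  then show ?case using sum_path_params_1[of "\<lambda>_. 1::nat" p] by simp
next
  case (Suc n)
  then show ?case using sum_path_params_Suc[of "Suc n" "\<lambda>_. 1::nat" p] by simp
qed

text \<open>The summands stand for block \<open>2 * k\<close>, the even blocks
  \<open>2 * (k + j) - 2\<close> and the odd blocks \<open>2 * (k + j) - 1\<close>. The last range
  omits \<open>j = s\<close>, since no block lies above that odd block.\<close>

definition descents :: "nat \<Rightarrow> nat \<Rightarrow> nat \<Rightarrow> nat \<Rightarrow> (nat \<Rightarrow> nat) \<Rightarrow> nat" where
  "descents p k s l u =
     of_bool (u 1 < (p - 1) div 2)
     + (\<Sum>j=2..s. of_bool (L'_num p k s l u j < (p - 1) div 2 * repunit p (Suc k)))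
     + (\<Sum>j=2..<s. of_bool ((p - 1 - u j) * repunit p (Suc k) < L'_num p k s l u (j + 1)))"

text \<open>The blocks compared all have \<open>p ^ k * (p - 1)\<close> nodes, so the inequality for
  the horizontal nodes is equivalent to the one for the vertical nodes, which the repunit criteria
  decide.\<close>

lemma des_eq_descents:
  assumes p: "p = 2 * t + 1" "1 \<le> t" and s: "1 \<le> s" and l: "l < p ^ k"
    and u: "u \<in> path_params p s" and P: "path_with_params p k s l u P"
  shows "des p k s P = descents p k s l u"
proof -
  have p3: "3 \<le> p" using p by simp
  note ctx = p3 s l u P
  let ?X = "L'_num p k s l u" and ?R = "repunit p (Suc k)"
  let ?A = "\<lambda>j. ?X j < (p - 1) div 2 * ?R"
  let ?B = "\<lambda>j. (p - 1 - u j) * ?R < ?X (j + 1)"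
  \<comment> \<open>\<open>C\<close>, \<open>D\<close> and \<open>E\<close> hold the descents at
    block \<open>2 * k\<close>, at even blocks and at odd blocks; the first lies below the range of
    the other two, which differ in parity.\<close>
  define C where "C = (if u 1 < (p - 1) div 2 then {2 * k} else {})"
  define D where "D = (\<lambda>j. 2 * (k + j) - 2) ` {j \<in> {2..s}. ?A j}"
  define E where "E = (\<lambda>j. 2 * (k + j) - 1) ` {j \<in> {2..<s}. ?B j}"
  have ul: "u j < p" if "2 \<le> j" "j \<le> s" for j using u_le[OF ctx that] p3 by simp
  have Xl: "?X j < p ^ Suc k" if "2 \<le> j" "j \<le> s" for j
    using L'_num_less[OF ctx L_num_less[OF ctx]] that by simp
  have nodd: "block_n P (2 * (k + j) - 1) = int ((p - 1 - u j) * p ^ k)"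
    and modd: "block_m P (2 * (k + j) - 1) = int (p ^ k * (p - 1)) - block_n P (2 * (k + j) - 1)"
    if "2 \<le> j" "j \<le> s" for j
  proof -
    have "int (p - 1 - u j) = int p - 1 - int (u j)" using ul[OF that] by linarith
    then show n: "block_n P (2 * (k + j) - 1) = int ((p - 1 - u j) * p ^ k)"
      using blocks_odd(2)[OF ctx that] by simp
    show "block_m P (2 * (k + j) - 1) = int (p ^ k * (p - 1)) - block_n P (2 * (k + j) - 1)"
      using blocks_odd[OF ctx that] p3 by (simp add: of_nat_diff algebra_simps)
  qed
  have neven: "block_n P (2 * (k + j) - 2) = int (?X j - ?X j div p)"
    and meven: "block_m P (2 * (k + j) - 2) = int (p ^ k * (p - 1)) - block_n P (2 * (k + j) - 2)"
    if "2 \<le> j" "j \<le> s" for j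
    using blocks_even[OF ctx that] p3 by (auto simp: of_nat_diff)
  have A: "?A j \<longleftrightarrow> block_n P (2 * (k + j) - 2) < block_n P (2 * (k + j) - 1)"
    if "2 \<le> j" "j \<le> s" for j
    unfolding neven[OF that] nodd[OF that] of_nat_less_iff
    using even_block_descent_iff[OF p(1) ul[OF that] L_num_less[OF ctx, of j], folded L'_num_def]
      that p by simp
  have B: "?B j \<longleftrightarrow> block_n P (2 * (k + j) - 1) < block_n P (2 * (k + j))"
    if "2 \<le> j" "j < s" for j
  proof -
    have j: "2 \<le> j + 1" "j + 1 \<le> s" "j \<le> s" using that by auto
    have e: "2 * (k + (j + 1)) - 2 = 2 * (k + j)" by simp
    show ?thesis
      unfolding neven[OF j(1,2), unfolded e] nodd[OF that(1) j(3)] of_nat_less_iff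
      using less_diff_div_iff[of "p - 1 - u j" p "?X (j + 1)" k] Xl[OF j(1,2)] p3 by simp
  qed
  have "descent_at p k s P i \<longleftrightarrow> i \<in> C \<union> D \<union> E" for i
  proof (cases "2 * k + 2 \<le> i \<and> i \<le> 2 * (k + s) - 2")
    case False
    have "i \<notin> D" "i \<notin> E" using False unfolding D_def E_def by auto
    moreover have "real_of_int (last_param p k P) < (real p - 1) / 2 \<longleftrightarrow> u 1 < (p - 1) div 2"
      using last_param_eq[OF ctx] p by simp
    ultimately show ?thesis using False unfolding descent_at_def C_def by auto
  next
    case True
    then have C: "i \<notin> C" unfolding C_def by auto
    show ?thesis
    proof (cases "even i")
      case True
      then obtain c where c: "i = 2 * c" by (elim evenE)
      \<comment> \<open>Blocks \<open>2 * (k + j) - 2\<close> and \<open>2 * (k + j) - 1\<close>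
        belong to the same \<open>j\<close>; the shift by one solves
        \<open>2 * c = 2 * (k + j) - 2\<close>.\<close>
      define j where "j = c - k + 1"
      have j: "2 \<le> j" "j \<le> s" "i = 2 * (k + j) - 2" "i + 1 = 2 * (k + j) - 1"
        using \<open>2 * k + 2 \<le> i \<and> _\<close> c unfolding j_def by auto
      have "i \<notin> E" unfolding E_def using True by (auto dest: arg_cong[of _ _ even])
      moreover have "x = j" if "i = 2 * (k + x) - 2" "x \<in> {2..s}" for x
        using that j(1,3) by auto
      then have "i \<in> D \<longleftrightarrow> ?A j" unfolding D_def using j(1-3) by auto
      ultimately show ?thesis
        using C A[OF j(1,2)] meven[OF j(1,2)] modd[OF j(1,2)] \<open>2 * k + 2 \<le> i \<and> _\<close>
        unfolding descent_at_def j(3)[symmetric] j(4)[symmetric] by auto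
    next
      case False
      then obtain c where c: "i = 2 * c + 1" by (elim oddE)
      define j where "j = c - k + 1"
      have j: "2 \<le> j" "j < s" "j \<le> s" "i = 2 * (k + j) - 1" "i + 1 = 2 * (k + j)"
        "2 \<le> j + 1" "j + 1 \<le> s" "i + 1 = 2 * (k + (j + 1)) - 2"
        using \<open>2 * k + 2 \<le> i \<and> _\<close> c unfolding j_def by auto
      have "i \<notin> D" unfolding D_def using False by (auto dest: arg_cong[of _ _ even])
      moreover have "x = j" if "i = 2 * (k + x) - 1" "x \<in> {2..<s}" for x
        using that j(1,4) by auto
      then have "i \<in> E \<longleftrightarrow> ?B j" unfolding E_def using j(1,2,4) by auto
      ultimately show ?thesis
        using C B[OF j(1,2)] meven[OF j(6,7)] modd[OF j(1,3)] \<open>2 * k + 2 \<le> i \<and> _\<close>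
        unfolding descent_at_def j(4,5,8)[symmetric] by auto
    qed
  qed
  then have "{i. descent_at p k s P i} = C \<union> D \<union> E" by blast
  then have "des p k s P = card (C \<union> D \<union> E)" unfolding des_def by simp
  also have "\<dots> = card C + card D + card E"
  proof -
    have "finite C" "finite D" "finite E" unfolding C_def D_def E_def by auto
    moreover have "C \<inter> D = {}" "C \<inter> E = {}" unfolding C_def D_def E_def by auto
    moreover have "D \<inter> E = {}"
    proof -
      have "even i" if "i \<in> D" for i using that unfolding D_def by auto
      moreover have "odd i" if "i \<in> E" for i using that unfolding E_def by auto
      ultimately show ?thesis by blast
    qed
    ultimately show ?thesis by (simp add: card_Un_disjoint Int_Un_distrib2)
  qed
  also have "card C = of_bool (u 1 < (p - 1) div 2)" unfolding C_def by simp
  also have "card D = (\<Sum>j=2..s. of_bool (?A j))"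
    unfolding D_def by (subst card_image) (auto simp: inj_on_def sum.If_cases of_bool_def Int_def)
  also have "card E = (\<Sum>j=2..<s. of_bool (?B j))"
    unfolding E_def by (subst card_image) (auto simp: inj_on_def sum.If_cases of_bool_def Int_def)
  finally show ?thesis unfolding descents_def by simp
qed

text \<open>Every recorded floor is \<open>2 * k + 1\<close> or an even or odd floor above it, and
  the parameters prescribe its vertex in each case; extensionality fixes all other values.\<close>

lemma path_with_params_unique:
  assumes "path_with_params p k s l u P" "path_with_params p k s l u Q"
  shows "P = Q"
proof (rule extensionalityI)
  show "P \<in> extensional {2 * k + 1..2 * (k + s)}" "Q \<in> extensional {2 * k + 1..2 * (k + s)}"
    using assms unfolding path_with_params_def by auto
  fix c assume c: "c \<in> {2 * k + 1..2 * (k + s)}"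
  consider "c = 2 * k + 1" | j where "j \<in> {1..s}" "c = 2 * (k + j)"
    | j where "j \<in> {2..s}" "c = 2 * (k + j) - 1"
  proof (cases "even c")
    case True
    then obtain b where b: "c = 2 * b" by (elim evenE)
    with c have "b - k \<in> {1..s}" "k + (b - k) = b" by (auto simp: Suc_le_eq)
    with b that(2)[of "b - k"] show ?thesis by simp
  next
    case False
    then obtain b where b: "c = 2 * b + 1" by (elim oddE)
    with c have "k \<le> b" "b < k + s" by auto
    with b that(1) that(3)[of "b - k + 1"] show ?thesis by (cases "b = k") (auto simp: Suc_le_eq)
  qed
  then show "P c = Q c" using assms unfolding path_with_params_def by cases auto
qed

text \<open>Each parameter function has exactly one path and each path exactly one parameter
  function, so the sum over paths can be reindexed.\<close>

lemma fib_number_eq_sum_descents: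
  assumes p: "p = 2 * t + 1" "1 \<le> t" and s: "1 \<le> s" and l: "l < p ^ k"
  shows "fib_number p k s l = (\<Sum>u\<in>path_params p s. descents p k s l u)"
proof -
  define f where "f u = (SOME P. path_with_params p k s l u P)" for u
  have f: "path_with_params p k s l u (f u)" for u
    unfolding f_def using path_params_exists[OF s] by (rule someI_ex)
  have "paths p k s l = f ` path_params p s"
    unfolding paths_def using f path_with_params_unique by blast
  moreover have "inj_on f (path_params p s)"
  proof (rule inj_onI)
    fix u w assume "u \<in> path_params p s" "w \<in> path_params p s" "f u = f w"
    moreover have "3 \<le> p" using p by simp
    ultimately show "u = w" using path_params_unique[OF _ s l, of u "f u" w] f[of u] f[of w] by simp
  qed
  ultimately have "fib_number p k s l = (\<Sum>u\<in>path_params p s. des p k s (f u))"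
    unfolding fib_number_def by (simp add: sum.reindex)
  then show ?thesis using des_eq_descents[OF p s l _ f] by simp
qed

section \<open>Recursion on the number of parameters\<close>

lemma L_down_shift:
  "L_down p k (Suc s) l (u(Suc s := v)) (Suc d) = L_down p k s ((l + p ^ k * v) div p) u d"
  by (induction d) auto

lemma L_num_shift:
  "j \<le> s \<Longrightarrow> L_num p k (Suc s) l (u(Suc s := v)) j = L_num p k s ((l + p ^ k * v) div p) u j"
  unfolding L_num_def using L_down_shift by (simp only: Suc_diff_le)

text \<open>Once the top digit \<open>v\<close> is inserted, the register runs as a shorter one
  started at \<open>(l + p ^ k * v) div p\<close>. The new comparisons belong to the even block
  right below and to the odd block of \<open>u s\<close>; for \<open>s = 1\<close> the latter is
  absent because \<open>u 1\<close> is accounted for at block \<open>2 * k\<close>.\<close>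

lemma descents_Suc:
  assumes "1 \<le> s"
  shows "descents p k (Suc s) l (u(Suc s := v)) = descents p k s ((l + p ^ k * v) div p) u
    + of_bool (l + p ^ k * v < (p - 1) div 2 * repunit p (Suc k))
    + (if 2 \<le> s then of_bool ((p - 1 - u s) * repunit p (Suc k) < l + p ^ k * v) else 0)"
proof -
  let ?L = "(l + p ^ k * v) div p" and ?u = "u(Suc s := v)"
  have X: "L'_num p k (Suc s) l ?u j = L'_num p k s ?L u j" if "j \<le> s" for j
    using that by (simp add: L'_num_def L_num_shift)
  have X': "L'_num p k (Suc s) l ?u (Suc s) = l + p ^ k * v"
    by (simp add: L'_num_def L_num_top)
  have A: "(\<Sum>j=2..Suc s. of_bool (L'_num p k (Suc s) l ?u j < h))
    = (\<Sum>j=2..s. of_bool (L'_num p k s ?L u j < h)) + (of_bool (l + p ^ k * v < h) :: nat)" for h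
  proof -
    have "(\<Sum>j=2..s. of_bool (L'_num p k (Suc s) l ?u j < h))
      = (\<Sum>j=2..s. of_bool (L'_num p k s ?L u j < h) :: nat)"
      using X by (intro sum.cong) auto
    then show ?thesis using assms X' by (simp only: sum.cl_ivl_Suc) simp
  qed
  have B: "(\<Sum>j=2..<Suc s. of_bool (h (?u j) < L'_num p k (Suc s) l ?u (j + 1)))
    = (\<Sum>j=2..<s. of_bool (h (u j) < L'_num p k s ?L u (j + 1)))
      + (if 2 \<le> s then of_bool (h (u s) < l + p ^ k * v) else (0::nat))" for h :: "nat \<Rightarrow> nat"
  proof -
    have "(\<Sum>j=2..<s. of_bool (h (?u j) < L'_num p k (Suc s) l ?u (j + 1)))
      = (\<Sum>j=2..<s. of_bool (h (u j) < L'_num p k s ?L u (j + 1)) :: nat)"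
      using X by (intro sum.cong) auto
    then show ?thesis using X' by (simp only: sum.op_ivl_Suc) simp
  qed
  have u1: "?u 1 = u 1" using assms by simp
  show ?thesis
    unfolding descents_def A u1 B[of "\<lambda>x. (p - 1 - x) * repunit p (Suc k)"] by simp
qed

text \<open>The sum of \<open>f (L'\<^sub>s\<^sub>-\<^sub>d)\<close> over all values of \<open>u\<^sub>s, \<dots>, u\<^sub>s\<^sub>-\<^sub>d\<close>.\<close>

primrec shift_sum :: "nat \<Rightarrow> nat \<Rightarrow> (nat \<Rightarrow> nat) \<Rightarrow> nat \<Rightarrow> nat \<Rightarrow> nat" where
  "shift_sum p k f 0 l = (\<Sum>v<p. f (l + p ^ k * v))"
| "shift_sum p k f (Suc d) l = (\<Sum>v<p. shift_sum p k f d ((l + p ^ k * v) div p))"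

lemma shift_div_less:
  fixes l p k v :: nat
  assumes "l < p ^ k" "v < p"
  shows "(l + p ^ k * v) div p < p ^ k"
proof -
  have "l + p ^ k * v < p ^ k * (v + 1)" using assms by simp
  also have "\<dots> \<le> p ^ k * p" using assms by (intro mult_left_mono) auto
  finally show ?thesis using assms by (simp add: less_mult_imp_div_less)
qed

text \<open>After \<open>d\<close> shifts the \<open>d\<close> lowest digits of \<open>l\<close> are
  gone; the remaining \<open>k - d\<close> sit at the bottom and the \<open>d + 1\<close> inserted
  digits form the free leading part \<open>w\<close>.\<close>

lemma shift_sum_digits:
  assumes "d \<le> k" "l < p ^ k"
  shows "shift_sum p k f d l = (\<Sum>w<p ^ (d + 1). f (w * p ^ (k - d) + l div p ^ d))"
  using assms
proof (induction d arbitrary: l)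
  case 0
  then show ?case by (simp add: algebra_simps)
next
  case (Suc d)
  let ?g = "\<lambda>w. f (w * p ^ (k - Suc d) + l div p ^ Suc d)"
  have e: "((l + p ^ k * v) div p) div p ^ d = l div p ^ Suc d + v * p ^ (k - Suc d)" if "v < p" for v
  proof -
    have "p ^ k = p ^ Suc d * p ^ (k - Suc d)"
      using Suc.prems by (metis le_add_diff_inverse power_add)
    then have "l + p ^ k * v = l + p ^ Suc d * (v * p ^ (k - Suc d))" by simp
    then have "(l + p ^ k * v) div p ^ Suc d = l div p ^ Suc d + v * p ^ (k - Suc d)"
      using that by (simp only:) simp
    then show ?thesis by (simp add: div_mult2_eq)
  qed
  have pk: "p ^ (k - d) = p * p ^ (k - Suc d)"
    using Suc.prems by (metis Suc_diff_Suc Suc_le_lessD power_Suc)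
  have "shift_sum p k f (Suc d) l
    = (\<Sum>v<p. \<Sum>w<p ^ (d + 1). f (w * p ^ (k - d) + ((l + p ^ k * v) div p) div p ^ d))"
    using Suc shift_div_less by simp
  \<comment> \<open>The digit \<open>v\<close> inserted first has moved furthest down, so it is the
    last digit of the new leading part \<open>w * p + v\<close>.\<close>
  also have "\<dots> = (\<Sum>v<p. \<Sum>w<p ^ (d + 1). ?g (w * p + v))"
  proof (intro sum.cong refl)
    fix v w assume "v \<in> {..<p}"
    then have "v < p" by simp
    show "f (w * p ^ (k - d) + ((l + p ^ k * v) div p) div p ^ d) = ?g (w * p + v)"
      unfolding e[OF \<open>v < p\<close>] pk by (simp add: algebra_simps)
  qed
  also have "\<dots> = (\<Sum>w<p ^ (d + 1). \<Sum>v<p. ?g (w * p + v))" by (rule sum.swap)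
  also have "\<dots> = (\<Sum>w<p ^ (d + 1). sum ?g {w * p..<w * p + p})"
  proof (rule sum.cong[OF refl])
    fix w
    show "(\<Sum>v<p. ?g (w * p + v)) = sum ?g {w * p..<w * p + p}"
      using sum.shift_bounds_nat_ivl[of ?g 0 "w * p" p]
      by (simp add: lessThan_atLeast0 add.commute)
  qed
  also have "\<dots> = sum ?g {..<p ^ (d + 1) * p}" by (rule sum.nat_group)
  finally show ?case by (simp add: mult.commute)
qed

text \<open>At \<open>d = k\<close> no digit of \<open>l\<close> is left and each
  \<open>X < p ^ (k + 1)\<close> occurs once; every further shift contributes a factor
  \<open>p\<close>.\<close>

lemma shift_sum_uniform:
  assumes "k \<le> d" "l < p ^ k"
  shows "shift_sum p k f d l = p ^ (d - k) * (\<Sum>X<p ^ (k + 1). f X)"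
  using assms
proof (induction d arbitrary: l rule: dec_induct)
  case base
  then show ?case by (simp add: shift_sum_digits)
next
  case (step d)
  then show ?case using shift_div_less by (simp add: Suc_diff_le)
qed

text \<open>The weights count the choices of the parameters not involved in a comparison. At depth
  \<open>d\<close> an even block involves \<open>d + 1\<close> of the \<open>n + 1\<close>
  parameters, an odd block one more, over whose values \<open>g\<close> sums. In both sums over
  \<open>d\<close> the parameter \<open>u 1\<close> stays free and gives the factor
  \<open>p - 1\<close>.\<close>

lemma sum_descents:
  fixes p k n l :: nat and f g :: "nat \<Rightarrow> nat"
  assumes "2 \<le> p"
  defines "f \<equiv> \<lambda>X. of_bool (X < (p - 1) div 2 * repunit p (Suc k))"
    and "g \<equiv> \<lambda>X. \<Sum>v<p. of_bool (v * repunit p (Suc k) < X)"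
  shows "(\<Sum>u\<in>path_params p (Suc n). descents p k (Suc n) l u)
    = (p - 1) div 2 * p ^ n
      + (p - 1) * (\<Sum>d<n. p ^ (n - 1 - d) * shift_sum p k f d l)
      + (p - 1) * (\<Sum>d<n - 1. p ^ (n - 2 - d) * shift_sum p k g d l)"
proof (induction n arbitrary: l)
  case 0
  have "{..p - 2} \<inter> {v. v < (p - Suc 0) div 2} = {..<(p - Suc 0) div 2}" by auto
  then show ?case using sum_path_params_1[of "descents p k 1 l" p] by (simp add: descents_def)
next
  case (Suc n)
  let ?l = "\<lambda>v. (l + p ^ k * v) div p" and ?P = "path_params p (Suc n)"
  let ?R = "repunit p (Suc k)"
  have p: "{..p - 1} = {..<p}" using assms by auto
  \<comment> \<open>All values of the parameter \<open>u (Suc n)\<close> occur equally often, and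
    reflecting \<open>v\<close> to \<open>p - 1 - v\<close> turns the sum over them into
    \<open>g X\<close>.\<close>
  have B: "(\<Sum>u\<in>?P. if 2 \<le> Suc n then of_bool ((p - 1 - u (Suc n)) * ?R < X) else 0)
    = (if n = 0 then 0 else (p - 1) * p ^ (n - 1) * g X)" for X
  proof (cases n)
    case (Suc m)
    have "(\<Sum>u\<in>?P. of_bool ((p - 1 - u (Suc n)) * ?R < X))
      = (\<Sum>v<p. (p - 1) * p ^ m * of_bool ((p - 1 - v) * ?R < X))"
      unfolding Suc using card_path_params[OF assms(1), of m]
      by (subst sum_path_params_Suc) (simp_all add: p[simplified])
    also have "\<dots> = (p - 1) * p ^ m * (\<Sum>v<p. of_bool ((p - Suc v) * ?R < X))"
      by (simp add: sum_distrib_left)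
    also have "(\<Sum>v<p. of_bool ((p - Suc v) * ?R < X)) = g X"
      unfolding g_def by (rule sum.nat_diff_reindex)
    finally show ?thesis using Suc by simp
  qed simp
  have "(\<Sum>u\<in>path_params p (Suc (Suc n)). descents p k (Suc (Suc n)) l u)
    = (\<Sum>v<p. \<Sum>u\<in>?P. descents p k (Suc n) (?l v) u + f (l + p ^ k * v)
        + (if 2 \<le> Suc n then of_bool ((p - 1 - u (Suc n)) * ?R < l + p ^ k * v) else 0))"
    using p by (simp only: sum_path_params_Suc descents_Suc f_def)
  also have "\<dots> = (\<Sum>v<p. (\<Sum>u\<in>?P. descents p k (Suc n) (?l v) u)
        + (p - 1) * p ^ n * f (l + p ^ k * v)
        + (if n = 0 then 0 else (p - 1) * p ^ (n - 1) * g (l + p ^ k * v)))"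
    unfolding sum.distrib B using card_path_params[OF assms(1), of n] by simp
  also have "\<dots> = (\<Sum>v<p. \<Sum>u\<in>?P. descents p k (Suc n) (?l v) u)
        + (p - 1) * p ^ n * shift_sum p k f 0 l
        + (if n = 0 then 0 else (p - 1) * p ^ (n - 1) * shift_sum p k g 0 l)"
    by (simp add: sum.distrib sum_distrib_left)
  also have "(\<Sum>v<p. \<Sum>u\<in>?P. descents p k (Suc n) (?l v) u)
    = (p - 1) div 2 * p ^ Suc n
      + (p - 1) * (\<Sum>d<n. p ^ (n - 1 - d) * shift_sum p k f (Suc d) l)
      + (p - 1) * (\<Sum>d<n - 1. p ^ (n - 2 - d) * shift_sum p k g (Suc d) l)"
  proof -
    have sw: "(\<Sum>v<p. \<Sum>d<m. a d * shift_sum p k h d (?l v))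
      = (\<Sum>d<m. a d * shift_sum p k h (Suc d) l)" for m h and a :: "nat \<Rightarrow> nat"
      by (subst sum.swap) (simp add: sum_distrib_left)
    show ?thesis unfolding Suc.IH sum.distrib sum_distrib_left[symmetric] sw by simp
  qed
  also have "(p - 1) div 2 * p ^ Suc n
      + (p - 1) * (\<Sum>d<n. p ^ (n - 1 - d) * shift_sum p k f (Suc d) l)
      + (p - 1) * (\<Sum>d<n - 1. p ^ (n - 2 - d) * shift_sum p k g (Suc d) l)
      + (p - 1) * p ^ n * shift_sum p k f 0 l
      + (if n = 0 then 0 else (p - 1) * p ^ (n - 1) * shift_sum p k g 0 l)
    = (p - 1) div 2 * p ^ Suc n
      + (p - 1) * (\<Sum>d<Suc n. p ^ (Suc n - 1 - d) * shift_sum p k f d l)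
      + (p - 1) * (\<Sum>d<Suc n - 1. p ^ (Suc n - 2 - d) * shift_sum p k g d l)"
  proof -
    have f: "(\<Sum>d<Suc n. p ^ (Suc n - 1 - d) * shift_sum p k f d l)
      = p ^ n * shift_sum p k f 0 l + (\<Sum>d<n. p ^ (n - 1 - d) * shift_sum p k f (Suc d) l)"
      unfolding sum.lessThan_Suc_shift by simp
    have g: "(\<Sum>d<Suc n - 1. p ^ (Suc n - 2 - d) * shift_sum p k g d l)
      = (if n = 0 then 0 else p ^ (n - 1) * shift_sum p k g 0 l)
        + (\<Sum>d<n - 1. p ^ (n - 2 - d) * shift_sum p k g (Suc d) l)"
    proof (cases n)
      case (Suc m)
      then show ?thesis
        by (simp only: diff_Suc_1 sum.lessThan_Suc_shift) simp
    qed simp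
    show ?thesis unfolding f g by (simp only: distrib_left mult.assoc) (simp del: shift_sum.simps)
  qed
  finally show ?case .
qed

section \<open>Counting register contents below or above a repunit multiple\<close>

lemma lex_less_iff:
  fixes w c m a b :: nat
  assumes "a < m" "b < m"
  shows "w * m + a < c * m + b \<longleftrightarrow> w < c \<or> w = c \<and> a < b"
proof (cases w c rule: linorder_cases)
  case less
  then have "(w + 1) * m \<le> c * m" by (intro mult_right_mono) auto
  then show ?thesis using less assms by simp
next
  case greater
  then have "(c + 1) * m \<le> w * m" by (intro mult_right_mono) auto
  then show ?thesis using greater assms by simp
qed simp

text \<open>\<open>v * repunit p (Suc k)\<close> splits into \<open>d + 1\<close> leading and
  \<open>k - d\<close> trailing digits. The leading parts \<open>w\<close> below
  \<open>v * repunit p (d + 1)\<close> all count, and the equal one counts according to the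
  remaining digits of \<open>l\<close>.\<close>

lemma shift_sum_below:
  assumes "v < p" "d \<le> k" "l < p ^ k"
  shows "shift_sum p k (\<lambda>X. of_bool (X < v * repunit p (Suc k))) d l
    = v * repunit p (d + 1) + of_bool (l div p ^ d < v * repunit p (k - d))"
proof -
  let ?c = "v * repunit p (d + 1)" and ?a = "l div p ^ d" and ?b = "v * repunit p (k - d)"
  have R: "v * repunit p (Suc k) = ?c * p ^ (k - d) + ?b"
    using assms repunit_add[of p "d + 1" "k - d"] by (simp add: algebra_simps)
  have a: "?a < p ^ (k - d)"
    using assms by (simp add: less_mult_imp_div_less flip: power_add)
  note lex = lex_less_iff[OF a mult_repunit_less[OF assms(1)]]
  have c: "?c < p ^ (d + 1)" using assms by (intro mult_repunit_less)
  have e: "{..<p ^ (d + 1)} \<inter> {w. w < ?c \<or> w = ?c \<and> ?a < ?b}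
    = (if ?a < ?b then {..?c} else {..<?c})" using c by auto
  have "shift_sum p k (\<lambda>X. of_bool (X < v * repunit p (Suc k))) d l
    = card ({..<p ^ (d + 1)} \<inter> {w. w < ?c \<or> w = ?c \<and> ?a < ?b})"
    unfolding shift_sum_digits[OF assms(2,3)] R lex by (subst sum_of_bool_eq) simp_all
  then show ?thesis unfolding e using c by simp
qed

text \<open>The same splitting, with the larger leading parts counted; the truncated differences are
  exact because \<open>v * repunit p (d + 1)\<close> is below \<open>p ^ (d + 1)\<close>.\<close>

lemma shift_sum_above:
  assumes "v < p" "d \<le> k" "l < p ^ k"
  shows "shift_sum p k (\<lambda>X. of_bool (v * repunit p (Suc k) < X)) d l
    = (p ^ (d + 1) - 1 - v * repunit p (d + 1)) + of_bool (v * repunit p (k - d) < l div p ^ d)"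
proof -
  let ?c = "v * repunit p (d + 1)" and ?a = "l div p ^ d" and ?b = "v * repunit p (k - d)"
  have R: "v * repunit p (Suc k) = ?c * p ^ (k - d) + ?b"
    using assms repunit_add[of p "d + 1" "k - d"] by (simp add: algebra_simps)
  have a: "?a < p ^ (k - d)"
    using assms by (simp add: less_mult_imp_div_less flip: power_add)
  note lex = lex_less_iff[OF mult_repunit_less[OF assms(1)] a]
  have c: "?c < p ^ (d + 1)" using assms by (intro mult_repunit_less)
  have e: "{..<p ^ (d + 1)} \<inter> {w. ?c < w \<or> ?c = w \<and> ?b < ?a}
    = (if ?b < ?a then {?c..<p ^ (d + 1)} else {?c<..<p ^ (d + 1)})" using c by auto
  have "shift_sum p k (\<lambda>X. of_bool (v * repunit p (Suc k) < X)) d l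
    = card ({..<p ^ (d + 1)} \<inter> {w. ?c < w \<or> ?c = w \<and> ?b < ?a})"
    unfolding shift_sum_digits[OF assms(2,3)] R lex by (subst sum_of_bool_eq) simp_all
  then show ?thesis unfolding e using c by simp
qed

lemma shift_sum_sum:
  assumes "finite V"
  shows "shift_sum p k (\<lambda>X. \<Sum>v\<in>V. f v X) d l = (\<Sum>v\<in>V. shift_sum p k (f v) d l)"
proof (induction d arbitrary: l)
  case 0
  then show ?case by (simp add: sum.swap[of _ V])
next
  case (Suc d)
  then show ?case by (simp add: sum.swap[of _ V])
qed

subsection \<open>Evaluation\<close>

lemma double_sum_multiples: "2 * (\<Sum>v<p. v * r) = p * ((p - 1) * r)" for r :: nat
proof -
  have g: "2 * (\<Sum>v<p. v) = p * (p - 1)"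
  proof (induction p)
    case (Suc p)
    have "2 * (\<Sum>v<Suc p. v) = 2 * (\<Sum>v<p. v) + 2 * p" by simp
    also have "\<dots> = p * (p - 1) + 2 * p" using Suc by simp
    also have "\<dots> = Suc p * (Suc p - 1)" by (cases p) simp_all
    finally show ?case .
  qed simp
  have "2 * (\<Sum>v<p. v * r) = 2 * (\<Sum>v<p. v) * r"
    unfolding mult.assoc sum_distrib_right ..
  then show ?thesis unfolding g mult.assoc .
qed

text \<open>The least \<open>l\<close> for which \<open>l div p ^ d\<close> exceeds
  \<open>v * repunit p (k - d)\<close>; the factor \<open>p ^ d\<close> removes the
  division.\<close>

definition threshold :: "nat \<Rightarrow> nat \<Rightarrow> nat \<Rightarrow> nat \<Rightarrow> nat" where
  "threshold p k v d = p ^ d * (v * repunit p (k - d) + 1)"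

text \<open>The part of the number of odd-block descents at depth \<open>d\<close> that depends on
  \<open>l\<close>.\<close>

definition above_count :: "nat \<Rightarrow> nat \<Rightarrow> nat \<Rightarrow> nat \<Rightarrow> nat" where
  "above_count p k l d = card {v. v < p \<and> threshold p k v d \<le> l}"

text \<open>The corresponding part for even blocks. It enters with a negative sign, since a descent
  there needs a small register content.\<close>

definition half_reached :: "nat \<Rightarrow> nat \<Rightarrow> nat \<Rightarrow> nat \<Rightarrow> bool" where
  "half_reached p k l d \<longleftrightarrow> p ^ d * ((p - 1) div 2 * repunit p (k - d)) \<le> l"

lemma le_div_iff: "x \<le> l div p ^ d \<longleftrightarrow> p ^ d * x \<le> l" if "1 \<le> p" for x l p d :: nat
  using that by (simp add: less_eq_div_iff_mult_less_eq mult.commute)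

context
  fixes p t k l :: nat
  assumes p: "p = 2 * t + 1" "1 \<le> t" and l: "l < p ^ k"
begin

text \<open>Since \<open>t\<close> is half of \<open>p - 1\<close>, the number
  \<open>t * repunit p (d + 1)\<close> of smaller leading parts is
  \<open>(p ^ (d + 1) - 1) / 2\<close>.\<close>

lemma real_shift_sum_below:
  assumes "d \<le> k"
  shows "real (shift_sum p k (\<lambda>X. of_bool (X < (p - 1) div 2 * repunit p (Suc k))) d l)
    = (real p ^ (d + 1) - 1) / 2 + 1 - of_bool (half_reached p k l d)"
proof -
  have "2 * (t * repunit p (d + 1)) + 1 = p ^ (d + 1)"
    using repunit_closed[of p "d + 1"] p by simp
  then have "2 * real (t * repunit p (d + 1)) + 1 = real p ^ (d + 1)"
    by (metis of_nat_1 of_nat_add of_nat_mult of_nat_numeral of_nat_power)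
  moreover have "half_reached p k l d \<longleftrightarrow> \<not> l div p ^ d < t * repunit p (k - d)"
    using le_div_iff[of p "t * repunit p (k - d)" l d] p unfolding half_reached_def by simp linarith
  ultimately show ?thesis
    using shift_sum_below[of t p d k l] assms p l by (simp add: field_simps)
qed

text \<open>The multiples \<open>v * repunit p (d + 1)\<close> have average
  \<open>(p ^ (d + 1) - 1) / 2\<close> over \<open>v < p\<close>; the indicators left over add up to
  \<open>above_count\<close>.\<close>

lemma real_shift_sum_above:
  assumes "d \<le> k"
  shows "real (shift_sum p k (\<lambda>X. \<Sum>v<p. of_bool (v * repunit p (Suc k) < X)) d l)
    = real p * (real p ^ (d + 1) - 1) / 2 + real (above_count p k l d)"
proof -
  let ?R = "repunit p (d + 1)" and ?T = "\<lambda>v. v * repunit p (k - d) < l div p ^ d"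
  have T: "?T v \<longleftrightarrow> threshold p k v d \<le> l" for v
    using le_div_iff[of p "v * repunit p (k - d) + 1" l d] p unfolding threshold_def by simp linarith
  have "shift_sum p k (\<lambda>X. \<Sum>v<p. of_bool (v * repunit p (Suc k) < X)) d l
    = (\<Sum>v<p. (p ^ (d + 1) - 1 - v * ?R) + of_bool (?T v))"
    unfolding shift_sum_sum[OF finite_lessThan]
    by (intro sum.cong refl shift_sum_above) (use assms l in auto)
  also have "\<dots> = (\<Sum>v<p. p ^ (d + 1) - 1 - v * ?R) + above_count p k l d"
    unfolding sum.distrib T above_count_def
    by (subst sum_of_bool_eq) (auto intro: arg_cong[of _ _ card])
  finally have e: "shift_sum p k (\<lambda>X. \<Sum>v<p. of_bool (v * repunit p (Suc k) < X)) d l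
    = (\<Sum>v<p. p ^ (d + 1) - 1 - v * ?R) + above_count p k l d" .
  have "real (p ^ (d + 1) - 1 - v * ?R) = real p ^ (d + 1) - 1 - real (v * ?R)" if "v < p" for v
    using mult_repunit_less[OF that, of "d + 1"] by (simp add: of_nat_diff)
  then have "real (\<Sum>v<p. p ^ (d + 1) - 1 - v * ?R)
      = real p * (real p ^ (d + 1) - 1) - real (\<Sum>v<p. v * ?R)"
    by (simp add: sum_subtractf)
  moreover have "2 * real (\<Sum>v<p. v * ?R) = real p * (real p ^ (d + 1) - 1)"
  proof -
    have "real ((p - 1) * ?R) = real p ^ (d + 1) - 1"
      using repunit_closed[of p "d + 1"] p
      by (metis add_diff_cancel_right' le_add2 of_nat_1 of_nat_add of_nat_power)
    then show ?thesis using double_sum_multiples[where p=p and r="?R"]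
      by (metis of_nat_mult of_nat_numeral)
  qed
  ultimately show ?thesis unfolding e by simp
qed

lemma fib_number_formula:
  assumes "k + 2 \<le> s"
  shows "real (fib_number p k s l) = real p ^ (s - 2 - k) * (real p - 1) / 2 *
    (2 * (real s - 1) * real p ^ (k + 1) - 2 * (real s - real k) + 3
      + 2 * ((\<Sum>d<k. real p ^ (k - 1 - d) * real (above_count p k l d))
        - real p * (\<Sum>d<k. real p ^ (k - 1 - d) * of_bool (half_reached p k l d))))"
proof -
  \<comment> \<open>With \<open>s = Suc (k + 1 + m)\<close> the even blocks have depths below
    \<open>k + 1 + m\<close> and the odd ones below \<open>k + m\<close>, so \<open>m + 1\<close>
    and \<open>m\<close> of these depths lie in the uniform range.\<close>
  define m where "m = s - 2 - k"
  have s: "s = Suc (k + 1 + m)" using assms m_def by simp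
  let ?f = "\<lambda>X. of_bool (X < (p - 1) div 2 * repunit p (Suc k))"
  let ?g = "\<lambda>X. \<Sum>v<p. of_bool (v * repunit p (Suc k) < X)"
  let ?c = "above_count p k l" and ?e = "\<lambda>d. of_bool (half_reached p k l d) :: real"
  define q where "q = real p"
  have q: "q > 0" using p unfolding q_def by simp
  have uni: "real (shift_sum p k f d l) = q ^ (d - k) * real (shift_sum p k f k l)" if "k \<le> d" for f d
    using shift_sum_uniform[OF that l, of f] shift_sum_uniform[OF order_refl l, of f]
    unfolding q_def by simp
  \<comment> \<open>At depth \<open>k\<close> the repunit is 0, so the half is reached trivially and
    the thresholds, all equal to \<open>p ^ k\<close>, exceed \<open>l\<close>. From there on
    nothing depends on \<open>l\<close>.\<close>
  have top: "half_reached p k l k" "?c k = 0"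
    using l by (auto simp: half_reached_def above_count_def threshold_def)
  have split: "(\<Sum>d<k + r. h d) = (\<Sum>d<k. h d) + (\<Sum>d<r. h (k + d))" for h :: "nat \<Rightarrow> real" and r
    by (induction r) (auto simp: add.assoc)
  have F: "(\<Sum>d<k + 1 + m. q ^ (k + m - d) * real (shift_sum p k ?f d l))
    = q ^ m * ((\<Sum>d<k. q ^ (k + 1) / 2 + q ^ (k - d) / 2 - q ^ (k - d) * ?e d)
        + (real m + 1) * (q ^ (k + 1) - 1) / 2)"
  proof -
    have "(\<Sum>d<k. q ^ (k + m - d) * real (shift_sum p k ?f d l))
      = (\<Sum>d<k. q ^ m * (q ^ (k + 1) / 2 + q ^ (k - d) / 2 - q ^ (k - d) * ?e d))"
    proof (intro sum.cong refl)
      fix d assume "d \<in> {..<k}"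
      then obtain c where c: "k = d + c" by (auto dest: less_imp_add_positive)
      have "real (shift_sum p k ?f d l) = (q ^ (d + 1) - 1) / 2 + 1 - ?e d"
        using real_shift_sum_below[of d] c unfolding q_def by simp
      moreover have "k + m - d = c + m" "k - d = c" "k + 1 = c + (d + 1)" using c by auto
      ultimately show "q ^ (k + m - d) * real (shift_sum p k ?f d l)
        = q ^ m * (q ^ (k + 1) / 2 + q ^ (k - d) / 2 - q ^ (k - d) * ?e d)"
        by (simp only: power_add) (simp add: field_simps)
    qed
    moreover have "(\<Sum>d<m + 1. q ^ (k + m - (k + d)) * real (shift_sum p k ?f (k + d) l))
      = (\<Sum>d<m + 1. q ^ m * ((q ^ (k + 1) - 1) / 2))"
    proof (intro sum.cong refl)
      fix d assume "d \<in> {..<m + 1}"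
      then have pw: "q ^ (m - d) * q ^ d = q ^ m" by (simp flip: power_add)
      have u: "real (shift_sum p k ?f (k + d) l) = q ^ d * ((q ^ (k + 1) - 1) / 2)"
        using uni[of "k + d" ?f] real_shift_sum_below[of k] top unfolding q_def by simp
      show "q ^ (k + m - (k + d)) * real (shift_sum p k ?f (k + d) l)
        = q ^ m * ((q ^ (k + 1) - 1) / 2)"
        unfolding add_diff_cancel_left u pw[symmetric] by (rule mult.assoc[symmetric])
    qed
    ultimately show ?thesis
      unfolding add.assoc[of k 1 m] add.commute[of 1 m] split
      by (simp add: sum_distrib_left[symmetric]) (simp add: algebra_simps)
  qed
  have G: "(\<Sum>d<k + m. q ^ (k + m - 1 - d) * real (shift_sum p k ?g d l))
    = q ^ m * ((\<Sum>d<k. q ^ (k + 1) / 2 - q ^ (k - d) / 2 + q ^ (k - 1 - d) * real (?c d))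
        + real m * (q ^ (k + 1) - 1) / 2)"
  proof -
    have "(\<Sum>d<k. q ^ (k + m - 1 - d) * real (shift_sum p k ?g d l))
      = (\<Sum>d<k. q ^ m * (q ^ (k + 1) / 2 - q ^ (k - d) / 2 + q ^ (k - 1 - d) * real (?c d)))"
    proof (intro sum.cong refl)
      fix d assume "d \<in> {..<k}"
      then obtain c where c: "k = d + 1 + c" by (auto simp: less_iff_Suc_add)
      have "real (shift_sum p k ?g d l) = q * (q ^ (d + 1) - 1) / 2 + real (?c d)"
        using real_shift_sum_above[of d] c unfolding q_def by simp
      moreover have "k + m - 1 - d = c + m" "k - d = c + 1" "k - 1 - d = c" "k + 1 = c + (d + 1) + 1"
        using c by auto
      ultimately show "q ^ (k + m - 1 - d) * real (shift_sum p k ?g d l)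
        = q ^ m * (q ^ (k + 1) / 2 - q ^ (k - d) / 2 + q ^ (k - 1 - d) * real (?c d))"
        by (simp only: power_add) (simp add: field_simps)
    qed
    moreover have "(\<Sum>d<m. q ^ (k + m - 1 - (k + d)) * real (shift_sum p k ?g (k + d) l))
      = (\<Sum>d<m. q ^ m * ((q ^ (k + 1) - 1) / 2))"
    proof (intro sum.cong refl)
      fix d assume "d \<in> {..<m}"
      then have "k + m - 1 - (k + d) + d + 1 = m" by auto
      then have pw: "q ^ (k + m - 1 - (k + d)) * q ^ d * q = q ^ m" by (metis power_add power_one_right)
      have u: "real (shift_sum p k ?g (k + d) l) = q ^ d * (q * ((q ^ (k + 1) - 1) / 2))"
        using uni[of "k + d" ?g] real_shift_sum_above[of k] top unfolding q_def by simp
      show "q ^ (k + m - 1 - (k + d)) * real (shift_sum p k ?g (k + d) l)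
        = q ^ m * ((q ^ (k + 1) - 1) / 2)"
        unfolding u pw[symmetric] by (simp only: mult.assoc)
    qed
    ultimately show ?thesis
      unfolding split by (simp add: sum_distrib_left[symmetric]) (simp add: algebra_simps)
  qed
  \<comment> \<open>The terms \<open>q ^ (k - d) / 2\<close> cancel between even and odd blocks. The
    even corrections carry one more power of \<open>q\<close>, hence the factor \<open>q\<close>
    before their sum.\<close>
  have sums: "(\<Sum>d<k. q ^ (k + 1) / 2 + q ^ (k - d) / 2 - q ^ (k - d) * ?e d)
      + (\<Sum>d<k. q ^ (k + 1) / 2 - q ^ (k - d) / 2 + q ^ (k - 1 - d) * real (?c d))
    = real k * q ^ (k + 1)
      + ((\<Sum>d<k. q ^ (k - 1 - d) * real (?c d)) - q * (\<Sum>d<k. q ^ (k - 1 - d) * ?e d))"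
  proof -
    have "q * (\<Sum>d<k. q ^ (k - 1 - d) * ?e d) = (\<Sum>d<k. q ^ (k - d) * ?e d)"
      unfolding sum_distrib_left
    proof (intro sum.cong refl)
      fix d assume "d \<in> {..<k}"
      then have "k - d = Suc (k - 1 - d)" by auto
      then show "q * (q ^ (k - 1 - d) * ?e d) = q ^ (k - d) * ?e d"
        by (simp only: power_Suc mult.assoc)
    qed
    then show ?thesis by (simp add: sum.distrib sum_subtractf)
  qed
  have idx: "k + 1 + m - 1 = k + m" "k + 1 + m - 2 = k + m - 1" by auto
  have half: "real ((p - 1) div 2) = real t" using p by simp
  have "2 \<le> p" "1 \<le> s" using p s by auto
  then have fib: "fib_number p k s l = (p - 1) div 2 * p ^ (k + 1 + m)
      + (p - 1) * (\<Sum>d<k + 1 + m. p ^ (k + m - d) * shift_sum p k ?f d l)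
      + (p - 1) * (\<Sum>d<k + m. p ^ (k + m - 1 - d) * shift_sum p k ?g d l)"
    using fib_number_eq_sum_descents[OF p _ l, of s]
      sum_descents[of p k "k + 1 + m" l, folded s, unfolded idx] by (simp only:)
  have pm: "real (p - 1) = q - 1" using p unfolding q_def by simp
  have "real (fib_number p k s l) = real t * q ^ (k + 1 + m)
      + (q - 1) * (\<Sum>d<k + 1 + m. q ^ (k + m - d) * real (shift_sum p k ?f d l))
      + (q - 1) * (\<Sum>d<k + m. q ^ (k + m - 1 - d) * real (shift_sum p k ?g d l))"
    by (simp only: fib of_nat_add of_nat_mult of_nat_sum of_nat_power pm half q_def[symmetric])
  also have "\<dots> = q ^ m * (q - 1) / 2 * (q ^ (k + 1)
      + 2 * ((\<Sum>d<k. q ^ (k + 1) / 2 + q ^ (k - d) / 2 - q ^ (k - d) * ?e d)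
      + (\<Sum>d<k. q ^ (k + 1) / 2 - q ^ (k - d) / 2 + q ^ (k - 1 - d) * real (?c d)))
      + (2 * real m + 1) * (q ^ (k + 1) - 1))"
  proof -
    have t: "real t = (q - 1) / 2" using p unfolding q_def by simp
    show ?thesis unfolding F G t power_add[of q "k + 1" m] by (simp add: field_simps)
  qed
  \<comment> \<open>As \<open>s - 1 = k + 1 + m\<close>, the powers \<open>q ^ (k + 1)\<close> have
    total coefficient \<open>2 * (s - 1)\<close>, and the constant \<open>2 * m + 1\<close> is
    \<open>2 * (s - k) - 3\<close>.\<close>
  also have "\<dots> = q ^ m * (q - 1) / 2 *
    (2 * (real s - 1) * q ^ (k + 1) - 2 * (real s - real k) + 3
      + 2 * ((\<Sum>d<k. q ^ (k - 1 - d) * real (?c d)) - q * (\<Sum>d<k. q ^ (k - 1 - d) * ?e d)))"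
    unfolding sums using s by (simp add: algebra_simps)
  finally show ?thesis unfolding q_def m_def .
qed

end

section \<open>Order of the thresholds\<close>

lemma threshold_mono:
  assumes "v < p" "d \<le> d'" "d' \<le> k"
  shows "threshold p k v d \<le> threshold p k v d'"
  using assms(2,3)
proof (induction rule: dec_induct)
  case (step d)
  have e: "k - d = Suc (k - Suc d)" using step by simp
  \<comment> \<open>Splitting off the last digit of the repunit multiple leaves
    \<open>v + 1\<close>, which is at most \<open>p\<close>.\<close>
  have "threshold p k v d \<le> p ^ d * (p * (v * repunit p (k - Suc d) + 1))"
    unfolding threshold_def e repunit_Suc_shift using assms(1)
    by (intro mult_left_mono) (auto simp: algebra_simps)
  also have "\<dots> = threshold p k v (Suc d)" by (simp only: threshold_def power_Suc mult_ac)
  finally show ?case using step by simp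
qed simp

lemma threshold_last: "1 \<le> k \<Longrightarrow> threshold p k v (k - 1) = p ^ (k - 1) * (v + 1)"
  unfolding threshold_def by (simp add: repunit_def)

lemma mult_repunit_ge:
  assumes "d < k"
  shows "v * p ^ (k - 1) \<le> p ^ d * (v * repunit p (k - d))"
proof -
  obtain c where c: "k = d + c + 1" using assms by (auto simp: less_iff_Suc_add)
  have "p ^ c \<le> repunit p (c + 1)" by (simp add: repunit_Suc)
  then have "v * p ^ c \<le> v * repunit p (c + 1)" by (rule mult_left_mono) simp
  then have "p ^ d * (v * p ^ c) \<le> p ^ d * (v * repunit p (c + 1))" by (rule mult_left_mono) simp
  then show ?thesis unfolding c by (simp add: power_add mult_ac)
qed

text \<open>The thresholds for \<open>v\<close> are at most the deepest one,
  \<open>Suc v * p ^ (k - 1)\<close>, and this power term is already contained in every threshold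
  for \<open>Suc v\<close>.\<close>

lemma threshold_lex:
  assumes "v < p" "d < k" "d' < k"
  shows "threshold p k v d' < threshold p k (Suc v) d"
proof -
  have "threshold p k v d' \<le> threshold p k v (k - 1)" using assms by (intro threshold_mono) auto
  also have "\<dots> = Suc v * p ^ (k - 1)" using threshold_last[of k p v] assms by simp
  also have "\<dots> \<le> p ^ d * (Suc v * repunit p (k - d))" using assms by (intro mult_repunit_ge)
  also have "\<dots> < threshold p k (Suc v) d" unfolding threshold_def using assms by simp
  finally show ?thesis .
qed

text \<open>For fixed \<open>d\<close> the thresholds do not decrease with \<open>v\<close>, so
  those reached by \<open>l\<close> form an initial segment.\<close>

lemma above_count_eqI:
  assumes "m \<le> p" "m = 0 \<or> threshold p k (m - 1) d \<le> l" "m = p \<or> l < threshold p k m d"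
  shows "above_count p k l d = m"
proof -
  have mono: "threshold p k v d \<le> threshold p k w d" if "v \<le> w" for v w
    unfolding threshold_def using that by (intro mult_left_mono add_right_mono mult_right_mono) auto
  have "threshold p k v d \<le> l" if "v < m" for v
  proof -
    have "v \<le> m - 1" "m \<noteq> 0" using that by auto
    then show ?thesis using mono[of v "m - 1"] assms(2) by auto
  qed
  moreover have "\<not> threshold p k v d \<le> l" if "m \<le> v" "v < p" for v
    using mono[of m v] that assms(3) by auto
  ultimately have "{v. v < p \<and> threshold p k v d \<le> l} = {..<m}"
    using assms(1) by (auto simp: not_less) (meson not_less)
  then show ?thesis unfolding above_count_def by simp
qed

text \<open>The upper bound is the lexicographic successor of
  \<open>threshold p k (\<tau> - 1) i\<close>. So index \<open>\<tau> - 1\<close> is reached only at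
  the depths \<open>d \<le> i\<close>, smaller indices at every depth and larger ones at
  none.\<close>

lemma above_count_eq:
  assumes "1 \<le> \<tau>" "\<tau> < p" "i < k" "d < k" and lo: "threshold p k (\<tau> - 1) i \<le> l"
    and up: "l < (if i = k - 1 then threshold p k \<tau> 0 else threshold p k (\<tau> - 1) (i + 1))"
  shows "above_count p k l d = (if d \<le> i then \<tau> else \<tau> - 1)"
proof (cases "d \<le> i")
  case True
  have "threshold p k (\<tau> - 1) d \<le> threshold p k (\<tau> - 1) i"
    using True assms by (intro threshold_mono) auto
  moreover have "l < threshold p k \<tau> d"
  proof (cases "i = k - 1")
    case True
    then show ?thesis using up threshold_mono[of \<tau> p 0 d k] assms by simp
  next
    case False
    then have "i + 1 < k" "\<tau> - 1 < p" "Suc (\<tau> - 1) = \<tau>" using assms by auto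
    then show ?thesis
      using False up threshold_lex[of "\<tau> - 1" p d k "i + 1"] assms(4) by simp
  qed
  ultimately show ?thesis using True assms by (intro above_count_eqI[THEN trans]) auto
next
  case False
  then have "threshold p k (\<tau> - 1) (i + 1) \<le> threshold p k (\<tau> - 1) d"
    using assms by (intro threshold_mono) auto
  then have 1: "l < threshold p k (\<tau> - 1) d" using up False assms by (auto split: if_splits)
  have 2: "\<tau> - 1 = 0 \<or> threshold p k (\<tau> - 1 - 1) d \<le> l"
  proof (cases "\<tau> - 1")
    case (Suc v)
    then have "v < p" using assms(2) by simp
    then show ?thesis using threshold_lex[of v p i k d] lo assms(3,4) Suc by simp
  qed simp
  show ?thesis using False assms 1 2 by (intro above_count_eqI[THEN trans]) auto
qed

section \<open>Weighted sums of the corrections\<close>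

lemma real_repunit: "real (repunit p m) = (\<Sum>j<m. real p ^ j)"
  by (simp add: repunit_def)

lemma sum_rev_powers:
  assumes "a \<le> k"
  shows "(\<Sum>d=a..<k. real p ^ (k - 1 - d)) = real (repunit p (k - a))"
proof -
  have "(\<Sum>d=a..<k. real p ^ (k - 1 - d)) = (\<Sum>d<k - a. real p ^ (k - a - Suc d))"
    using assms sum.shift_bounds_nat_ivl[of "\<lambda>d. real p ^ (k - 1 - d)" 0 a "k - a"]
    by (simp add: lessThan_atLeast0 add.commute)
  also have "\<dots> = (\<Sum>d<k - a. real p ^ d)" by (rule sum.nat_diff_reindex)
  finally show ?thesis by (simp add: real_repunit)
qed

lemma sum_if_atLeastLessThan:
  fixes f :: "nat \<Rightarrow> real"
  shows "(\<Sum>d<k. if d \<in> {a..<k} then f d else 0) = (\<Sum>d=a..<k. f d)"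
proof -
  have "{..<k} \<inter> {a..<k} = {a..<k}" by auto
  then show ?thesis by (metis finite_lessThan sum.inter_restrict)
qed

text \<open>The count is \<open>\<tau>\<close> up to depth \<open>i\<close> and one less beyond; the
  weights beyond \<open>i\<close> add up to \<open>repunit p (k - Suc i)\<close>.\<close>

lemma sum_above_count:
  assumes "1 \<le> \<tau>" "\<tau> < p" "i < k" "threshold p k (\<tau> - 1) i \<le> l"
    and "l < (if i = k - 1 then threshold p k \<tau> 0 else threshold p k (\<tau> - 1) (i + 1))"
  shows "(\<Sum>d<k. real p ^ (k - 1 - d) * real (above_count p k l d))
    = real \<tau> * real (repunit p k) - real (repunit p (k - Suc i))"
proof -
  have "(\<Sum>d<k. real p ^ (k - 1 - d) * real (above_count p k l d))
    = (\<Sum>d<k. real \<tau> * real p ^ (k - 1 - d) - (if d \<in> {Suc i..<k} then real p ^ (k - 1 - d) else 0))"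
    using above_count_eq[OF assms(1-3) _ assms(4,5)] assms(1)
    by (intro sum.cong refl) (auto simp: of_nat_diff algebra_simps)
  also have "\<dots> = real \<tau> * (\<Sum>d=0..<k. real p ^ (k - 1 - d)) - (\<Sum>d=Suc i..<k. real p ^ (k - 1 - d))"
    unfolding sum_subtractf sum_if_atLeastLessThan by (simp add: sum_distrib_left lessThan_atLeast0)
  finally show ?thesis using assms(3) by (simp add: sum_rev_powers[simplified])
qed

lemma sum_half_reached:
  assumes "a \<le> k" "\<And>d. d < k \<Longrightarrow> half_reached p k l d \<longleftrightarrow> a \<le> d"
  shows "(\<Sum>d<k. real p ^ (k - 1 - d) * of_bool (half_reached p k l d)) = real (repunit p (k - a))"
proof -
  have "(\<Sum>d<k. real p ^ (k - 1 - d) * of_bool (half_reached p k l d))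
    = (\<Sum>d<k. if d \<in> {a..<k} then real p ^ (k - 1 - d) else 0)"
    using assms(2) by (intro sum.cong refl) auto
  also have "\<dots> = (\<Sum>d=a..<k. real p ^ (k - 1 - d))"
    by (rule sum_if_atLeastLessThan)
  finally show ?thesis using sum_rev_powers[OF assms(1)] by simp
qed

lemma interval_sum_repunit:
  fixes p :: nat
  assumes "d < k"
  shows "(\<Sum>\<iota>=d..k - 1. p ^ \<iota>) = p ^ d * repunit p (k - d)"
proof -
  have "{d..k - 1} = {0 + d..<k - d + d}" using assms by auto
  then have "(\<Sum>\<iota>=d..k - 1. p ^ \<iota>) = (\<Sum>\<iota>=0..<k - d. p ^ (\<iota> + d))"
    by (simp only: sum.shift_bounds_nat_ivl)
  then show ?thesis by (simp add: repunit_def lessThan_atLeast0 power_add sum_distrib_left mult.commute)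
qed

text \<open>Brings the thresholds into the form in which the theorem writes its interval
  ends.\<close>

lemma threshold_eq:
  "d < k \<Longrightarrow> threshold p k v d = v * (\<Sum>\<iota>=d..k - 1. p ^ \<iota>) + p ^ d"
  by (simp only: interval_sum_repunit threshold_def) (simp add: algebra_simps)

lemma half_reached_iff:
  "d < k \<Longrightarrow> half_reached p k l d \<longleftrightarrow> (p - 1) div 2 * (\<Sum>\<iota>=d..k - 1. p ^ \<iota>) \<le> l"
  by (simp only: interval_sum_repunit half_reached_def mult.left_commute)

lemma interval_sum_antimono:
  fixes p :: nat
  shows "d \<le> d' \<Longrightarrow> (\<Sum>\<iota>=d'..k. p ^ \<iota>) \<le> (\<Sum>\<iota>=d..k. p ^ \<iota>)"
  by (intro sum_mono2) auto

lemma real_interval_sum: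
  assumes "a \<le> Suc b"
  shows "(\<Sum>j=a..b. real p ^ j) = real (repunit p (Suc b)) - real (repunit p a)"
proof -
  have "{..<Suc b} = {..<a} \<union> {a..b}" "{..<a} \<inter> {a..b} = {}" using assms by auto
  then have "(\<Sum>j<Suc b. real p ^ j) = (\<Sum>j<a. real p ^ j) + (\<Sum>j=a..b. real p ^ j)"
    by (simp only: sum.union_disjoint finite_lessThan finite_atLeastAtMost)
  then show ?thesis by (simp add: real_repunit)
qed

section \<open>Evaluation on the intervals of the theorem\<close>

context
  fixes p t k l :: nat
  assumes p: "p = 2 * t + 1" "1 \<le> t" and k: "2 \<le> k"
begin

lemma half: "(p - 1) div 2 = t"
  using p by simp

lemma sum_powers_repunit: "(\<Sum>j=0..k - 1. real p ^ j) = real (repunit p k)"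
  using real_interval_sum[of 0 "k - 1" p] k by simp

text \<open>The upper end is one less than a positive threshold, so the truncated subtraction loses
  nothing. The second bound later shows, for \<open>\<tau> \<le> t\<close>, that the half is reached
  at no depth below \<open>k\<close>.\<close>

lemma below_inner_threshold:
  assumes "1 \<le> \<tau>" "\<tau> < p" "i \<le> k - 2"
    and "l \<le> (\<tau> - 1) * (\<Sum>\<iota>=i + 1..k - 1. p ^ \<iota>) + p ^ (i + 1) - 1"
  shows "l < threshold p k (\<tau> - 1) (i + 1)" "l < \<tau> * p ^ (k - 1)"
proof -
  have i: "i + 1 < k" using assms(3) k by linarith
  have "0 < p ^ (i + 1)" using p by simp
  then show 1: "l < threshold p k (\<tau> - 1) (i + 1)"
    unfolding threshold_eq[OF i] using assms(4) by linarith
  also have "\<dots> \<le> threshold p k (\<tau> - 1) (k - 1)"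
    using i assms by (intro threshold_mono) auto
  also have "\<dots> = \<tau> * p ^ (k - 1)" using threshold_last[of k p "\<tau> - 1"] k assms by simp
  finally show "l < \<tau> * p ^ (k - 1)" .
qed

lemma sum_above_count_inner:
  assumes "1 \<le> \<tau>" "\<tau> < p" "i \<le> k - 2"
    and "(\<tau> - 1) * (\<Sum>\<iota>=i..k - 1. p ^ \<iota>) + p ^ i \<le> l"
    and "l \<le> (\<tau> - 1) * (\<Sum>\<iota>=i + 1..k - 1. p ^ \<iota>) + p ^ (i + 1) - 1"
  shows "(\<Sum>d<k. real p ^ (k - 1 - d) * real (above_count p k l d))
    = real \<tau> * (\<Sum>j=0..k - 1. real p ^ j) - (\<Sum>\<mu>=0..k - i - 2. real p ^ \<mu>)"
proof -
  have i: "i < k" "i \<noteq> k - 1" "Suc (k - i - 2) = k - Suc i" using assms(3) k by auto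
  have "(\<Sum>d<k. real p ^ (k - 1 - d) * real (above_count p k l d))
    = real \<tau> * real (repunit p k) - real (repunit p (k - Suc i))"
    using below_inner_threshold(1)[OF assms(1-3,5)] assms(1,2,4) i
    by (intro sum_above_count) (auto simp: threshold_eq)
  moreover have "(\<Sum>\<mu>=0..k - i - 2. real p ^ \<mu>) = real (repunit p (k - Suc i))"
    using real_interval_sum[of 0 "k - i - 2" p] unfolding i by simp
  ultimately show ?thesis by (simp only: sum_powers_repunit)
qed

text \<open>The interval runs from the deepest threshold of index \<open>\<tau> - 1\<close> to just
  below the first one of index \<open>\<tau>\<close>, which exceeds the upper end by
  \<open>p ^ 0 = 1\<close>. No depth is left beyond \<open>k - 1\<close>, so nothing is
  subtracted.\<close>

lemma sum_above_count_last:
  assumes "1 \<le> \<tau>" "\<tau> < p"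
    and "\<tau> * p ^ (k - 1) \<le> l" "l \<le> \<tau> * (\<Sum>\<iota>=0..k - 1. p ^ \<iota>)"
  shows "(\<Sum>d<k. real p ^ (k - 1 - d) * real (above_count p k l d))
    = real \<tau> * (\<Sum>j=0..k - 1. real p ^ j)"
proof -
  have "threshold p k (\<tau> - 1) (k - 1) \<le> l"
    using threshold_last[of k p "\<tau> - 1"] k assms by (simp add: mult.commute)
  moreover have "l < threshold p k \<tau> 0" using assms(4) k by (subst threshold_eq) auto
  ultimately have "(\<Sum>d<k. real p ^ (k - 1 - d) * real (above_count p k l d))
    = real \<tau> * real (repunit p k) - real (repunit p (k - Suc (k - 1)))"
    using assms(1,2) k by (intro sum_above_count) auto
  moreover have "Suc (k - 1) = k" using k by simp
  ultimately show ?thesis by (simp add: sum_powers_repunit del: One_nat_def)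
qed

text \<open>Each bound in \<open>half_reached\<close> contains the top power and is thus at least
  \<open>t * p ^ (k - 1)\<close>.\<close>

lemma sum_half_reached_none:
  assumes "l < t * p ^ (k - 1)"
  shows "(\<Sum>d<k. real p ^ (k - 1 - d) * of_bool (half_reached p k l d)) = 0"
proof -
  have "\<not> half_reached p k l d" if "d < k" for d
    using mult_repunit_ge[OF that, of t p] assms unfolding half_reached_def half by linarith
  then show ?thesis by simp
qed

text \<open>The half bounds decrease with the depth, so reaching the one at depth 0 implies reaching
  all.\<close>

lemma sum_half_reached_all:
  assumes "t * (\<Sum>\<iota>=0..k - 1. p ^ \<iota>) \<le> l"
  shows "(\<Sum>d<k. real p ^ (k - 1 - d) * of_bool (half_reached p k l d))
    = (\<Sum>j=0..k - 1. real p ^ j)"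
proof -
  have "half_reached p k l d" if "d < k" for d
  proof -
    have "t * (\<Sum>\<iota>=d..k - 1. p ^ \<iota>) \<le> t * (\<Sum>\<iota>=0..k - 1. p ^ \<iota>)"
      by (intro mult_left_mono interval_sum_antimono) auto
    then show ?thesis unfolding half_reached_iff[OF that] half using assms by (rule order_trans)
  qed
  then have "(\<Sum>d<k. real p ^ (k - 1 - d) * of_bool (half_reached p k l d)) = real (repunit p k)"
    using sum_half_reached[of 0 k p l] by simp
  moreover have "Suc (k - 1) = k" using k by simp
  ultimately show ?thesis by (simp add: sum_powers_repunit del: One_nat_def)
qed

text \<open>Since \<open>\<tau> - 1\<close> is at least \<open>t\<close>, every threshold of that
  index exceeds the largest half bound, the one at depth 0.\<close>

lemma half_threshold_le:
  assumes "t < \<tau>" "\<tau> < p" "i < k" "threshold p k (\<tau> - 1) i \<le> l"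
  shows "t * (\<Sum>\<iota>=0..k - 1. p ^ \<iota>) \<le> l"
proof -
  have "t * (\<Sum>\<iota>=0..k - 1. p ^ \<iota>) \<le> (\<tau> - 1) * (\<Sum>\<iota>=0..k - 1. p ^ \<iota>)"
    using assms by (intro mult_right_mono) auto
  also have "\<dots> \<le> threshold p k (\<tau> - 1) 0" using k by (subst threshold_eq) auto
  also have "\<dots> \<le> threshold p k (\<tau> - 1) i" using assms by (intro threshold_mono) auto
  finally show ?thesis using assms(4) by simp
qed

text \<open>The half bounds decrease with the depth, so \<open>l\<close> between two neighbours
  reaches those at depths \<open>d \<ge> i\<close> only. The other two conclusions put
  \<open>l\<close> into the last interval for \<open>t\<close>, which determines
  \<open>above_count\<close>.\<close>

lemma sum_half_reached_some:
  assumes "1 \<le> i" "i \<le> k - 1" "t * (\<Sum>\<iota>=i..k - 1. p ^ \<iota>) \<le> l"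
    and "l \<le> t * (\<Sum>\<iota>=i - 1..k - 1. p ^ \<iota>) - 1"
  shows "(\<Sum>d<k. real p ^ (k - 1 - d) * of_bool (half_reached p k l d)) = real (repunit p (k - i))"
    and "l \<le> t * (\<Sum>\<iota>=0..k - 1. p ^ \<iota>)" and "t * p ^ (k - 1) \<le> l"
proof -
  let ?S = "\<lambda>d. \<Sum>\<iota>=d..k - 1. p ^ \<iota>"
  have mono: "t * ?S d' \<le> t * ?S d" if "d \<le> d'" for d d'
    using that by (intro mult_left_mono interval_sum_antimono) auto
  have "t * p ^ (k - 1) = t * ?S (k - 1)" by simp
  also have "\<dots> \<le> t * ?S i" using assms(2) by (rule mono)
  finally show last: "t * p ^ (k - 1) \<le> l" using assms(3) by (rule order_trans)
  \<comment> \<open>Positivity of \<open>l\<close> ensures that the truncated subtraction in the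
    upper bound is a true one.\<close>
  have "0 < t * p ^ (k - 1)" using p by simp
  with last have "0 < l" by linarith
  then have up: "l < t * ?S (i - 1)" using assms(4) by linarith
  show "l \<le> t * ?S 0" using mono[of 0 "i - 1"] up by linarith
  have "half_reached p k l d \<longleftrightarrow> i \<le> d" if "d < k" for d
  proof (cases "i \<le> d")
    case True
    have "half_reached p k l d"
      unfolding half_reached_iff[OF that] half using mono[OF True] assms(3) by (rule order_trans)
    then show ?thesis using True by simp
  next
    case False
    then have "d \<le> i - 1" by simp
    from mono[OF this] have "\<not> half_reached p k l d"
      unfolding half_reached_iff[OF that] half using up by linarith
    then show ?thesis using False by simp
  qed
  then show "(\<Sum>d<k. real p ^ (k - 1 - d) * of_bool (half_reached p k l d)) = real (repunit p (k - i))"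
    using assms by (intro sum_half_reached) auto
qed

end

section \<open>Assembly of the closed formulas\<close>

theorem theorem27:
  fixes p k s l :: nat
  assumes "prime p" and "odd p" and "2 \<le> k" and "k + 2 \<le> s" and "l < p ^ k"
  shows
    "(l = 0 \<longrightarrow>
        real (fib_number p k s l) = real p ^ (s - 2 - k) * (real p - 1) / 2 *
          (2 * (real s - 1) * real p ^ (k + 1) - 2 * (real s - real k) + 3))
     \<and>
     (\<forall>t. 1 \<le> t \<and> t \<le> (p - 3) div 2 \<longrightarrow>
        (\<forall>i. i \<le> k - 2 \<and>
           (t - 1) * (\<Sum>\<iota>=i..k - 1. p ^ \<iota>) + p ^ i \<le> l \<and>
           l \<le> (t - 1) * (\<Sum>\<iota>=i + 1..k - 1. p ^ \<iota>) + p ^ (i + 1) - 1 \<longrightarrow>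
           real (fib_number p k s l) = real p ^ (s - 2 - k) * (real p - 1) / 2 *
             (2 * (real s - 1) * real p ^ (k + 1) - 2 * (real s - real k) + 3
              + 2 * real t * (\<Sum>j=0..k - 1. real p ^ j) - 2 * (\<Sum>\<mu>=0..k - i - 2. real p ^ \<mu>)))
        \<and>
        (t * p ^ (k - 1) \<le> l \<and> l \<le> t * (\<Sum>\<iota>=0..k - 1. p ^ \<iota>) \<longrightarrow>
           real (fib_number p k s l) = real p ^ (s - 2 - k) * (real p - 1) / 2 *
             (2 * (real s - 1) * real p ^ (k + 1) - 2 * (real s - real k) + 3
              + 2 * real t * (\<Sum>j=0..k - 1. real p ^ j))))
     \<and>
     (\<forall>i. i \<le> k - 2 \<and>
        (p - 3) div 2 * (\<Sum>\<iota>=i..k - 1. p ^ \<iota>) + p ^ i \<le> l \<and>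
        l \<le> (p - 3) div 2 * (\<Sum>\<iota>=i + 1..k - 1. p ^ \<iota>) + p ^ (i + 1) - 1 \<longrightarrow>
        real (fib_number p k s l) = real p ^ (s - 2 - k) * (real p - 1) / 2 *
          (2 * (real s - 1) * real p ^ (k + 1) - 2 * (real s - real k) + 3
           + (real p - 1) * (\<Sum>j=0..k - 1. real p ^ j) - 2 * (\<Sum>\<mu>=0..k - i - 2. real p ^ \<mu>)))
     \<and>
     (\<forall>i'. 1 \<le> i' \<and> i' \<le> k - 1 \<and>
        (p - 1) div 2 * (\<Sum>\<iota>=i'..k - 1. p ^ \<iota>) \<le> l \<and>
        l \<le> (p - 1) div 2 * (\<Sum>\<iota>=i' - 1..k - 1. p ^ \<iota>) - 1 \<longrightarrow>
        real (fib_number p k s l) = real p ^ (s - 2 - k) * (real p - 1) / 2 *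
          (2 * (real s - 1) * real p ^ (k + 1) - 2 * (real s - real k) + 3
           - real p ^ k - 2 * (\<Sum>\<theta>=1..k - 1. real p ^ \<theta>)
           + 2 * (\<Sum>\<mu>=k - i' + 1..k. real p ^ \<mu>) - 1))
     \<and>
     (l = (p - 1) div 2 * (\<Sum>\<iota>=0..k - 1. p ^ \<iota>) \<longrightarrow>
        real (fib_number p k s l) = real p ^ (s - 2 - k) * (real p - 1) / 2 *
          (2 * (real s - 1) * real p ^ (k + 1) - 2 * (real s - real k) + 3
           - real p ^ k - 2 * (\<Sum>\<theta>=1..k - 1. real p ^ \<theta>) - 1))
     \<and>
     (\<forall>t. (p + 1) div 2 \<le> t \<and> t \<le> p - 1 \<longrightarrow>
        (\<forall>i. i \<le> k - 2 \<and>
           (t - 1) * (\<Sum>\<iota>=i..k - 1. p ^ \<iota>) + p ^ i \<le> l \<and>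
           l \<le> (t - 1) * (\<Sum>\<iota>=i + 1..k - 1. p ^ \<iota>) + p ^ (i + 1) - 1 \<longrightarrow>
           real (fib_number p k s l) = real p ^ (s - 2 - k) * (real p - 1) / 2 *
             (2 * (real s - 1) * real p ^ (k + 1) - 2 * (real s - real k) + 3
              + 2 * (real t - real p) * (\<Sum>j=0..k - 1. real p ^ j)
              - 2 * (\<Sum>\<mu>=0..k - i - 2. real p ^ \<mu>)))
        \<and>
        (t * p ^ (k - 1) \<le> l \<and> l \<le> t * (\<Sum>\<iota>=0..k - 1. p ^ \<iota>) \<longrightarrow>
           real (fib_number p k s l) = real p ^ (s - 2 - k) * (real p - 1) / 2 *
             (2 * (real s - 1) * real p ^ (k + 1) - 2 * (real s - real k) + 3
              + (2 * real t - 2 * real p) * (\<Sum>j=0..k - 1. real p ^ j))))"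
proof -
  have "p \<noteq> 2" "2 \<le> p" using assms(1,2) prime_ge_2_nat by auto
  then obtain t where p: "p = 2 * t + 1" "1 \<le> t" using assms(2) by (auto elim!: oddE)
  note ctx = p assms(3)
  have t: "(p - 3) div 2 = t - 1" "(p - 1) div 2 = t" "(p + 1) div 2 = t + 1" using p by auto
  have rt: "2 * real t = real p - 1" using p by simp
  define C where "C = (\<Sum>d<k. real p ^ (k - 1 - d) * real (above_count p k l d))"
  define E :: real where "E = (\<Sum>d<k. real p ^ (k - 1 - d) * of_bool (half_reached p k l d))"
  define R where "R = (\<Sum>j=0..k - 1. real p ^ j)"
  define base where "base = 2 * (real s - 1) * real p ^ (k + 1) - 2 * (real s - real k) + 3"
  \<comment> \<open>All cases share this form, so each has only to evaluate \<open>C\<close> and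
    \<open>E\<close>.\<close>
  have F: "real (fib_number p k s l) = real p ^ (s - 2 - k) * (real p - 1) / 2 * x"
    if "x = base + 2 * (C - real p * E)" for x
    unfolding that base_def C_def E_def by (rule fib_number_formula[OF p assms(5,4)])
  note inner = sum_above_count_inner[where l = l, OF ctx, folded C_def R_def]
  note last = sum_above_count_last[where l = l, OF ctx, folded C_def R_def]
  note none = sum_half_reached_none[where l = l, OF ctx, folded E_def]
  note all = sum_half_reached_all[where l = l, OF ctx, folded E_def R_def]
  note some = sum_half_reached_some[where l = l, OF ctx, folded E_def]
  note below = below_inner_threshold(2)[where l = l, OF ctx]
  have early: "l < t * p ^ (k - 1)" if "l < \<tau> * p ^ (k - 1)" "\<tau> \<le> t" for \<tau>
    using that by (meson less_le_trans mult_le_mono1)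
  have R: "R = real (repunit p k)" unfolding R_def by (rule sum_powers_repunit[OF ctx])
  \<comment> \<open>Some of the formulas contain \<open>p ^ k\<close> itself; it is expressed
    through \<open>R\<close> to make them comparable with \<open>C\<close> and
    \<open>E\<close>.\<close>
  have "real ((p - 1) * repunit p k + 1) = real (p ^ k)" using repunit_closed[of p k] p by simp
  then have pk: "real p ^ k = (real p - 1) * R + 1" using p by (simp add: R)
  have low: "(\<Sum>\<theta>=1..k - 1. real p ^ \<theta>) = R - 1"
    using real_interval_sum[of 1 "k - 1" p] assms(3) by (simp add: R repunit_def)
  show ?thesis unfolding R_def[symmetric] base_def[symmetric] t
  proof (intro conjI allI impI, goal_cases)
    case 1
    \<comment> \<open>Every threshold is positive, so \<open>l = 0\<close> reaches none.\<close>
    have "C = 0" unfolding C_def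
    proof (intro sum.neutral ballI)
      fix d
      have "above_count p k l d = 0"
        using 1 p by (intro above_count_eqI) (auto simp: threshold_def)
      then show "real p ^ (k - 1 - d) * real (above_count p k l d) = 0" by simp
    qed
    moreover have "E = 0" by (rule none) (use 1 p in simp)
    ultimately show ?case by (intro F) simp
  next
    case (2 \<tau> i)
    then have \<tau>: "1 \<le> \<tau>" "\<tau> < p" "\<tau> \<le> t" using p by auto
    note i = 2(2)[THEN conjunct1] 2(2)[THEN conjunct2, THEN conjunct1]
      2(2)[THEN conjunct2, THEN conjunct2]
    have "C = real \<tau> * R - (\<Sum>\<mu>=0..k - i - 2. real p ^ \<mu>)" by (rule inner[OF \<tau>(1,2) i])
    moreover have "E = 0" by (rule none[OF early[OF below[OF \<tau>(1,2) i(1,3)] \<tau>(3)]])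
    ultimately show ?case by (intro F) algebra
  next
    case (3 \<tau>)
    then have \<tau>: "1 \<le> \<tau>" "\<tau> < p" "\<tau> + 1 \<le> t" using p by auto
    have "C = real \<tau> * R" using last[OF \<tau>(1,2)] 3(2) by simp
    \<comment> \<open>Here \<open>\<tau>\<close> is at most \<open>t - 1\<close>, so this bound
      keeps \<open>l\<close> below every half bound.\<close>
    moreover have "l < (\<tau> + 1) * p ^ (k - 1)"
    proof -
      have "l < threshold p k \<tau> 0" using 3(2) assms(3) p by (subst threshold_eq) auto
      also have "\<dots> \<le> threshold p k \<tau> (k - 1)" using \<tau> by (intro threshold_mono) auto
      also have "\<dots> = (\<tau> + 1) * p ^ (k - 1)" using threshold_last[of k p \<tau>] assms(3) by simp
      finally show ?thesis .
    qed
    then have "E = 0" by (rule none[OF early[OF _ \<tau>(3)]])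
    ultimately show ?case by (intro F) algebra
  next
    case (4 i)
    have \<tau>: "1 \<le> t" "t < p" using p by auto
    note i = 4[THEN conjunct1] 4[THEN conjunct2, THEN conjunct1]
      4[THEN conjunct2, THEN conjunct2]
    have "C = real t * R - (\<Sum>\<mu>=0..k - i - 2. real p ^ \<mu>)" by (rule inner[OF \<tau> i])
    moreover have "E = 0" by (rule none[OF below[OF \<tau> i(1,3)]])
    ultimately show ?case using rt by (intro F) algebra
  next
    case (5 i)
    have \<tau>: "1 \<le> t" "t < p" using p by auto
    note i = 5[THEN conjunct1] 5[THEN conjunct2, THEN conjunct1]
      5[THEN conjunct2, THEN conjunct2, THEN conjunct1]
      5[THEN conjunct2, THEN conjunct2, THEN conjunct2]
    define r where "r = real (repunit p (k - i))"
    \<comment> \<open>The sum is a difference of repunits of lengths \<open>k + 1\<close> and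
      \<open>k - i + 1\<close>; their units cancel and leave a factor \<open>p\<close>.\<close>
    have high: "(\<Sum>\<mu>=k - i + 1..k. real p ^ \<mu>) = real p * R - real p * r"
      using real_interval_sum[of "k - i + 1" k p] i(1)
      by (simp add: repunit_Suc_shift R r_def)
    have "C = real t * R" by (rule last[OF \<tau> some(3)[OF i] some(2)[OF i]])
    moreover have "E = r" unfolding r_def by (rule some(1)[OF i])
    ultimately have e: "2 * (C - real p * E) = (real p - 1) * R - 2 * real p * r"
      unfolding rt[symmetric] by (simp add: algebra_simps)
    show ?case unfolding low high pk by (intro F, unfold e) (simp add: algebra_simps)
  next
    case 6
    have \<tau>: "1 \<le> t" "t < p" using p by auto
    have S: "p ^ (k - 1) \<le> (\<Sum>\<iota>=0..k - 1. p ^ \<iota>)" by (rule member_le_sum) auto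
    have "C = real t * R" by (rule last[OF \<tau>]) (use 6 S in auto)
    moreover have "E = R" by (rule all) (use 6 in simp)
    ultimately have e: "2 * (C - real p * E) = (real p - 1) * R - 2 * real p * R"
      unfolding rt[symmetric] by (simp add: algebra_simps)
    show ?case unfolding low pk by (intro F, unfold e) (simp add: algebra_simps)
  next
    case (7 \<tau> i)
    then have \<tau>: "1 \<le> \<tau>" "\<tau> < p" "t < \<tau>" using p by auto
    note i = 7(2)[THEN conjunct1] 7(2)[THEN conjunct2, THEN conjunct1]
      7(2)[THEN conjunct2, THEN conjunct2]
    have "C = real \<tau> * R - (\<Sum>\<mu>=0..k - i - 2. real p ^ \<mu>)" by (rule inner[OF \<tau>(1,2) i])
    \<comment> \<open>Above the half every even correction is present, and subtracting
      \<open>p * R\<close> turns the coefficient \<open>\<tau>\<close> of \<open>R\<close> into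
      \<open>\<tau> - p\<close>.\<close>
    moreover have "i < k" using i(1) assms(3) by simp
    then have "E = R"
      using i(2) by (intro all half_threshold_le[OF ctx \<tau>(3,2)]) (auto simp: threshold_eq)
    ultimately show ?case by (intro F) algebra
  next
    case (8 \<tau>)
    then have \<tau>: "1 \<le> \<tau>" "\<tau> < p" "t < \<tau>" using p by auto
    have "C = real \<tau> * R" using last[OF \<tau>(1,2)] 8(2) by simp
    moreover have "threshold p k (\<tau> - 1) (k - 1) \<le> l"
      using threshold_last[of k p "\<tau> - 1"] 8(2) \<tau> assms(3) by (simp add: mult.commute)
    then have "E = R" using assms(3) by (intro all half_threshold_le[OF ctx \<tau>(3,2)]) auto
    ultimately show ?case by (intro F) algebra
  qed
qed

end
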